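(* Let $E$ be a Banach space. If there exist an infinite Tychonoff space $X$ and a homeomorphism $T: C_p(X) \to E_{w}$, then (a) $X$ is a countable union of compact sets $X_n$, $n \in \omega$, where at least one of the sets $X_n$ is non-scattered; and (b) $E$ contains a closed subspace isomorphic to the Banach space $\ell_{1}$.
   Context: For a Tychonoff space $X$, $C_p(X)$ denotes the space of all continuous real-valued functions on $X$ with the topology of pointwise convergence. For a Banach space $E$, $E_w$ denotes $E$ endowed with its weak topology. A topological space is scattered if every nonempty subspace has an isolated point. *)

theory Defs
  imports "HOL-Analysis.Analysis"
begin

definition tychonoff_space :: "'a topology \<Rightarrow> bool" where
  "tychonoff_space X \<longleftrightarrow> completely_regular_space X \<and> Hausdorff_space X"

definition Cp :: "'a topology \<Rightarrow> ('a \<Rightarrow> real) topology" where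
  "Cp X = subtopology (product_topology (\<lambda>_. euclideanreal) (topspace X))
            {f. continuous_map X euclideanreal f \<and> f \<in> extensional (topspace X)}"

definition weak_topology :: "('e::real_normed_vector) topology" where
  "weak_topology = topology_generated_by
     {f -` U | (f :: 'e \<Rightarrow> real) U. bounded_linear f \<and> open U}"

definition scattered_in :: "'a topology \<Rightarrow> 'a set \<Rightarrow> bool" where
  "scattered_in X S \<longleftrightarrow>
     (\<forall>A. A \<subseteq> S \<and> A \<noteq> {} \<longrightarrow> (\<exists>x\<in>A. \<exists>U. openin X U \<and> U \<inter> A = {x}))"

definition ell1 :: "(nat \<Rightarrow> real) set" where
  "ell1 = {x. summable (\<lambda>n. \<bar>x n\<bar>)}"

definition ell1_norm :: "(nat \<Rightarrow> real) \<Rightarrow> real" where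
  "ell1_norm x = (\<Sum>n. \<bar>x n\<bar>)"

definition contains_closed_copy_of_ell1 :: "'e::real_normed_vector itself \<Rightarrow> bool" where
  "contains_closed_copy_of_ell1 TYPE('e) \<longleftrightarrow>
     (\<exists>(V::'e set) (T::(nat \<Rightarrow> real) \<Rightarrow> 'e) c C.
        subspace V \<and> closed V \<and> bij_betw T ell1 V \<and>
        (\<forall>x\<in>ell1. \<forall>y\<in>ell1. T (\<lambda>n. x n + y n) = T x + T y) \<and>
        (\<forall>x\<in>ell1. \<forall>a::real. T (\<lambda>n. a * x n) = a *\<^sub>R T x) \<and>
        0 < c \<and> 0 < C \<and>
        (\<forall>x\<in>ell1. c * ell1_norm x \<le> norm (T x) \<and> norm (T x) \<le> C * ell1_norm x))"

end

theory Submission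
  imports Defs
begin

text \<open>
  Continuity of \<open>T\<close> and of its inverse relates finite subsets of \<open>X\<close> to finite sets of functionals on \<open>E\<close>.
  The points of \<open>X\<close> whose evaluation is controlled by \<open>m\<close> functionals of norm at most \<open>m\<close> have compact
  closure, because the \<open>m\<close>-tuples of such functionals form a weak* compact set (Okunev's argument);
  hence \<open>X\<close> is \<open>\<sigma>\<close>-compact.

  The weak topology of \<open>E\<close> has countable tightness but is not Frechet--Urysohn: some countable set
  clusters weakly at 0 and contains no weakly null sequence. Its preimage under \<open>T\<close> is a countable family
  of functions on \<open>X\<close>, and these combine to a continuous map \<open>h\<close> of \<open>X\<close> into \<open>\<real>\<^sup>\<nat>\<close> with uncountable image,
  since otherwise pointwise convergence along the family would be metrizable. Continuous metrizable images
  of compact scattered sets are countable, so some compact piece of \<open>X\<close> is not scattered.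

  By Baire's theorem, \<open>T\<close> is bounded on a uniform ball of functions of the form \<open>g \<circ> h\<close>. Uncountably many
  points of \<open>X\<close> with distinct \<open>h\<close>-values are controlled by the same number of functionals of bounded norm;
  discarding countably many of them, every finite pattern of constraints that occurs occurs infinitely
  often. This allows one to build a bounded sequence in \<open>E\<close> on which the functionals are independent in the
  sense of Rosenthal, and such a sequence spans \<open>\<ell>\<^sub>1\<close>.
\<close>

subsection \<open>Functionals on normed spaces\<close>

text \<open>Zorn's lemma is applied to graphs of partial functionals, viewed as subspaces of \<open>E \<times> \<real>\<close>: the bound
  \<open>t \<le> norm x\<close> on a subspace already forces it to be single-valued.\<close>

lemma Hahn_Banach_norming:
  fixes e :: "'e::real_normed_vector"
  obtains \<phi> :: "'e \<Rightarrow>\<^sub>L real" where "norm \<phi> \<le> 1" "blinfun_apply \<phi> e = norm e"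
proof -
  define \<A> where "\<A> = {G :: ('e \<times> real) set. subspace G \<and> (\<forall>(x,t)\<in>G. t \<le> norm x) \<and> (e, norm e) \<in> G}"
  have "span {(e, norm e)} \<in> \<A>"
  proof -
    have "t \<le> norm x" if "(x,t) \<in> span {(e, norm e)}" for x t
      using that by (auto simp: span_singleton intro!: mult_right_mono)
    then show ?thesis unfolding \<A>_def by (auto simp: span_base)
  qed
  moreover have "\<Union>\<C> \<in> \<A>" if ne: "\<C> \<noteq> {}" and ch: "subset.chain \<A> \<C>" for \<C>
  proof -
    have sub: "\<C> \<subseteq> \<A>" and lin: "\<And>G H. G \<in> \<C> \<Longrightarrow> H \<in> \<C> \<Longrightarrow> G \<subseteq> H \<or> H \<subseteq> G"
      using ch unfolding subset_chain_def by auto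
    have "subspace (\<Union>\<C>)"
    proof (rule subspaceI)
      show "0 \<in> \<Union>\<C>"
        using ne sub subspace_0 unfolding \<A>_def by blast
      show "x + y \<in> \<Union>\<C>" if xy: "x \<in> \<Union>\<C>" "y \<in> \<Union>\<C>" for x y
      proof -
        obtain G H where GH: "G \<in> \<C>" "H \<in> \<C>" "x \<in> G" "y \<in> H" using xy by blast
        then obtain K where "K \<in> \<C>" "x \<in> K" "y \<in> K" using lin by blast
        then show ?thesis using sub subspace_add unfolding \<A>_def by blast
      qed
      show "c *\<^sub>R x \<in> \<Union>\<C>" if "x \<in> \<Union>\<C>" for c x
        using that sub subspace_scale unfolding \<A>_def by blast
    qed
    then show ?thesis using ne sub unfolding \<A>_def by blast
  qed
  ultimately obtain G where G: "G \<in> \<A>" and max: "\<And>H. H \<in> \<A> \<Longrightarrow> G \<subseteq> H \<Longrightarrow> H = G"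
    using subset_Zorn_nonempty[of \<A>] by blast
  have sG: "subspace G" and le: "\<And>x t. (x,t) \<in> G \<Longrightarrow> t \<le> norm x" and eG: "(e, norm e) \<in> G"
    using G unfolding \<A>_def by auto
  have abs_le: "\<bar>t\<bar> \<le> norm x" if "(x,t) \<in> G" for x t
    using le[OF that] le[of "-x" "-t"] subspace_neg[OF sG that] by auto
  have uniq: "s = t" if "(x,s) \<in> G" "(x,t) \<in> G" for x s t
    using abs_le[of 0 "s - t"] subspace_diff[OF sG that] by auto
  have total: "\<exists>t. (x0,t) \<in> G" for x0
  proof -
    \<comment> \<open>A value at \<open>x0\<close> extends \<open>G\<close> admissibly if it lies
      above all left-hand sides and below all right-hand sides; their separation leaves room for the
      supremum \<open>c\<close>.\<close>
    have key: "t - norm (x - x0) \<le> norm (y + x0) - s" if "(x,t) \<in> G" "(y,s) \<in> G" for x t y s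
    proof -
      have "t + s \<le> norm (x + y)"
        using le[of "x+y" "t+s"] subspace_add[OF sG that] by auto
      also have "\<dots> \<le> norm (x - x0) + norm (y + x0)"
        using norm_triangle_ineq[of "x - x0" "y + x0"] by simp
      finally show ?thesis by simp
    qed
    define B where "B = {t - norm (x - x0) |x t. (x,t) \<in> G}"
    have B0: "B \<noteq> {}" unfolding B_def using eG by blast
    have Bb: "b \<le> norm (y + x0) - s" if "b \<in> B" "(y,s) \<in> G" for b y s
      using that key unfolding B_def by blast
    define c where "c = Sup B"
    have bdd: "bdd_above B" using Bb eG by (meson bdd_above.I)
    have c1: "t - norm (x - x0) \<le> c" if "(x,t) \<in> G" for x t
      unfolding c_def using that by (intro cSup_upper bdd) (auto simp: B_def)
    have c2: "c \<le> norm (y + x0) - s" if "(y,s) \<in> G" for y s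
      unfolding c_def using that Bb B0 by (intro cSup_least) auto
    define H where "H = {g + a *\<^sub>R (x0,c) |g a. g \<in> G}"
    have GH: "G \<subseteq> H" unfolding H_def by (intro subsetI CollectI exI[where x="0::real"] exI conjI) (auto simp: zero_prod_def)
    have "(x0,c) \<in> H"
    proof -
      have "(x0,c) = 0 + 1 *\<^sub>R (x0,c)" by (simp only: scaleR_one add_0_left)
      then show ?thesis unfolding H_def using subspace_0[OF sG] by blast
    qed
    moreover have "subspace H"
    proof (rule subspaceI)
      show "0 \<in> H" using GH subspace_0[OF sG] by auto
      fix u v assume "u \<in> H" "v \<in> H"
      then obtain g a g' a' where gg: "g \<in> G" "g' \<in> G" "u = g + a *\<^sub>R (x0,c)" "v = g' + a' *\<^sub>R (x0,c)"
        unfolding H_def by blast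
      have "u + v = (g + g') + (a + a') *\<^sub>R (x0,c)"
        unfolding gg(3,4) scaleR_add_left by (simp only: ac_simps)
      then show "u + v \<in> H" unfolding H_def using subspace_add[OF sG gg(1,2)] by blast
    next
      fix r u assume "u \<in> H"
      then obtain g a where gg: "g \<in> G" "u = g + a *\<^sub>R (x0,c)" unfolding H_def by blast
      have "r *\<^sub>R u = r *\<^sub>R g + (r * a) *\<^sub>R (x0,c)" unfolding gg(2) by (simp only: scaleR_add_right scaleR_scaleR)
      then show "r *\<^sub>R u \<in> H" unfolding H_def using subspace_scale[OF sG gg(1)] by blast
    qed
    \<comment> \<open>Dividing by \<open>\<bar>a\<bar>\<close> reduces the bound on the enlarged
      graph to \<open>a = 1\<close> and \<open>a = -1\<close>, which are the two bounds on
      \<open>c\<close>.\<close>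
    moreover have "t + a * c \<le> norm (x + a *\<^sub>R x0)" if g: "(x,t) \<in> G" for x t a
    proof -
      consider "a = 0" | "a > 0" | "a < 0" by linarith
      then show ?thesis
      proof cases
        case 1 then show ?thesis using le[OF g] by simp
      next
        case 2
        have "c \<le> norm ((1/a) *\<^sub>R x + x0) - (1/a) * t"
          using c2 subspace_scale[OF sG g, of "1/a"] by auto
        then have "a * c \<le> a * (norm ((1/a) *\<^sub>R x + x0) - (1/a) * t)"
          using 2 by (intro mult_left_mono) auto
        also have "\<dots> = a * norm ((1/a) *\<^sub>R x + x0) - t" using 2 by (simp add: field_simps)
        also have "a * norm ((1/a) *\<^sub>R x + x0) = norm (a *\<^sub>R ((1/a) *\<^sub>R x + x0))" using 2 by simp
        also have "a *\<^sub>R ((1/a) *\<^sub>R x + x0) = x + a *\<^sub>R x0" using 2 by (simp add: scaleR_add_right)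
        finally show ?thesis by simp
      next
        case 3
        define b where "b = - a"
        have b: "b > 0" using 3 b_def by simp
        have "(1/b) * t - norm ((1/b) *\<^sub>R x - x0) \<le> c"
          using c1 subspace_scale[OF sG g, of "1/b"] by auto
        then have "b * ((1/b) * t - norm ((1/b) *\<^sub>R x - x0)) \<le> b * c"
          using b by (intro mult_left_mono) auto
        also have "b * ((1/b) * t - norm ((1/b) *\<^sub>R x - x0)) = t - b * norm ((1/b) *\<^sub>R x - x0)" using b by (simp add: field_simps)
        also have "b * norm ((1/b) *\<^sub>R x - x0) = norm (b *\<^sub>R ((1/b) *\<^sub>R x - x0))" using b by simp
        also have "b *\<^sub>R ((1/b) *\<^sub>R x - x0) = x + a *\<^sub>R x0" using b by (simp add: scaleR_diff_right b_def)
        finally show ?thesis by (simp add: b_def)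
      qed
    qed
    ultimately have "subspace H" "\<And>x t. (x,t) \<in> H \<Longrightarrow> t \<le> norm x"
      unfolding H_def by auto
    then have "H \<in> \<A>" using GH eG unfolding \<A>_def by auto
    then have "H = G" using max GH by blast
    with \<open>(x0,c) \<in> H\<close> show ?thesis by auto
  qed
  define f where "f x = (THE t. (x,t) \<in> G)" for x
  have fG: "(x, f x) \<in> G" for x
    unfolding f_def using total[of x] uniq by (metis theI)
  have "bounded_linear f"
  proof (rule bounded_linear_intro[of _ 1])
    show "f (x + y) = f x + f y" for x y
      using uniq[OF fG[of "x+y"]] subspace_add[OF sG fG[of x] fG[of y]] by auto
    show "f (r *\<^sub>R x) = r *\<^sub>R f x" for r x
      using uniq[OF fG[of "r *\<^sub>R x"]] subspace_scale[OF sG fG[of x], of r] by auto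
    show "norm (f x) \<le> norm x * 1" for x using abs_le[OF fG[of x]] by simp
  qed
  then have ap: "blinfun_apply (Blinfun f) = f" by (rule bounded_linear_Blinfun_apply)
  show thesis
  proof
    show "norm (Blinfun f) \<le> 1"
      by (rule norm_blinfun_bound) (use abs_le[OF fG] ap in auto)
    show "blinfun_apply (Blinfun f) e = norm e" using ap uniq[OF fG eG] by simp
  qed
qed

text \<open>Some functional of norm at most 1 attains the norm of \<open>e\<close>. In this form
  norm balls are intersections of weakly closed half-spaces, which is needed where only weak
  continuity is at hand.\<close>

lemma norm_le_iff_functionals:
  fixes e :: "'e::real_normed_vector"
  shows "norm e \<le> r \<longleftrightarrow> (\<forall>\<phi> :: 'e \<Rightarrow>\<^sub>L real. norm \<phi> \<le> 1 \<longrightarrow> blinfun_apply \<phi> e \<le> r)"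
proof
  show "\<forall>\<phi> :: 'e \<Rightarrow>\<^sub>L real. norm \<phi> \<le> 1 \<longrightarrow> blinfun_apply \<phi> e \<le> r" if "norm e \<le> r"
  proof (intro allI impI)
    fix \<phi> :: "'e \<Rightarrow>\<^sub>L real" assume "norm \<phi> \<le> 1"
    then have "norm \<phi> * norm e \<le> 1 * norm e" by (intro mult_right_mono) auto
    then show "\<phi> e \<le> r" using norm_blinfun[of \<phi> e] that by auto
  qed
  show "norm e \<le> r" if "\<forall>\<phi> :: 'e \<Rightarrow>\<^sub>L real. norm \<phi> \<le> 1 \<longrightarrow> blinfun_apply \<phi> e \<le> r"
    using that Hahn_Banach_norming[of e] by metis
qed

section \<open>Baire category and uniform boundedness\<close>

lemma Baire_closed_cover:
  fixes C :: "nat \<Rightarrow> 'a::complete_space set"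
  assumes "\<And>n. closed (C n)" "(\<Union>n. C n) = UNIV"
  obtains n x \<epsilon> where "\<epsilon> > 0" "cball x \<epsilon> \<subseteq> C n"
proof -
  have "\<exists>n. interior (C n) \<noteq> {}"
  proof (rule ccontr)
    assume "\<not> ?thesis"
    then have "euclidean interior_of \<Union>(range C) = {}"
      using assms(1) completely_metrizable_space_euclidean
      by (intro Baire_category_alt) auto
    then show False using assms(2) by simp
  qed
  then obtain n x where "x \<in> interior (C n)" by blast
  then show thesis using that by (meson mem_interior_cball)
qed

text \<open>Uniform boundedness principle. The Baire argument runs in the dual, which is complete:
  the functionals bounded by \<open>n\<close> along the sequence form closed sets covering it, and a
  ball inside one of them gives a uniform bound.\<close>

lemma weakly_bounded_imp_bounded:
  fixes y :: "nat \<Rightarrow> 'e::real_normed_vector"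
  assumes "\<And>\<phi> :: 'e \<Rightarrow>\<^sub>L real. Bseq (\<lambda>k. blinfun_apply \<phi> (y k))"
  shows "Bseq y"
proof -
  define C where "C n = {\<phi> :: 'e \<Rightarrow>\<^sub>L real. \<forall>k. \<bar>blinfun_apply \<phi> (y k)\<bar> \<le> real n}" for n
  have "closed (C n)" for n
    unfolding C_def by (intro closed_Collect_all closed_Collect_le continuous_intros)
  moreover have "(\<Union>n. C n) = UNIV"
  proof -
    have "\<exists>n. \<phi> \<in> C n" for \<phi>
      using assms[of \<phi>] unfolding C_def Bseq_def
      by simp (meson order_trans real_arch_simple)
    then show ?thesis by blast
  qed
  ultimately obtain n \<phi>0 \<epsilon> where \<epsilon>: "\<epsilon> > 0" and sub: "cball \<phi>0 \<epsilon> \<subseteq> C n"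
    by (rule Baire_closed_cover)
  have "norm (y k) \<le> 2 * real n / \<epsilon>" for k
  proof (rule iffD2[OF norm_le_iff_functionals], intro allI impI)
    fix \<phi> :: "'e \<Rightarrow>\<^sub>L real" assume "norm \<phi> \<le> 1"
    then have "\<epsilon> * norm \<phi> \<le> \<epsilon> * 1"
      using \<epsilon> by (intro mult_left_mono) auto
    then have "\<phi>0 + \<epsilon> *\<^sub>R \<phi> \<in> cball \<phi>0 \<epsilon>" "\<phi>0 \<in> cball \<phi>0 \<epsilon>"
      using \<epsilon> by (simp_all add: dist_norm)
    then have "\<phi>0 + \<epsilon> *\<^sub>R \<phi> \<in> C n" "\<phi>0 \<in> C n" using sub by blast+
    then have "\<bar>\<phi>0 (y k) + \<epsilon> * \<phi> (y k)\<bar> \<le> n" "\<bar>\<phi>0 (y k)\<bar> \<le> n"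
      unfolding C_def by (auto simp: plus_blinfun.rep_eq scaleR_blinfun.rep_eq)
    then have "\<epsilon> * \<phi> (y k) \<le> 2 * n" by linarith
    then show "\<phi> (y k) \<le> 2 * real n / \<epsilon>" using \<epsilon> by (simp add: field_simps)
  qed
  then show ?thesis by (rule BseqI')
qed

text \<open>The Banach--Alaoglu theorem for sequences of functionals, in the form of a finite subcover.\<close>

lemma finitely_many_vectors_for_bounded_tuples:
  fixes A :: "'e::real_normed_vector set"
  assumes r: "r \<ge> 0"
    and cover: "\<And>\<phi> :: nat \<Rightarrow> 'e \<Rightarrow>\<^sub>L real. (\<And>i. norm (\<phi> i) \<le> r) \<Longrightarrow> \<exists>a\<in>A. \<forall>i<m. blinfun_apply (\<phi> i) a < 1"
  shows "\<exists>A0. finite A0 \<and> A0 \<subseteq> A \<and> (\<forall>\<phi> :: nat \<Rightarrow> 'e \<Rightarrow>\<^sub>L real. (\<forall>i. norm (\<phi> i) \<le> r) \<longrightarrow>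
    (\<exists>a\<in>A0. \<forall>i<m. blinfun_apply (\<phi> i) a < 1))"
proof -
  \<comment> \<open>\<open>Q\<close> is a Tychonoff cube containing the values of all tuples of norm
    at most \<open>r\<close>, and \<open>L\<close> cuts out the linear ones. Thus
    \<open>Q \<inter> L\<close> models the weak* compact set of these tuples.\<close>
  define Q :: "(nat \<times> 'e \<Rightarrow> real) set" where "Q = Pi UNIV (\<lambda>(i,e). {- r * norm e .. r * norm e})"
  define L :: "(nat \<times> 'e \<Rightarrow> real) set" where
    "L = {g. (\<forall>i x y. g (i, x + y) = g (i, x) + g (i, y)) \<and> (\<forall>i c x. g (i, c *\<^sub>R x) = c * g (i, x))}"
  have "compactin (product_topology (\<lambda>_. euclidean) UNIV) Q"
    unfolding Q_def PiE_UNIV_domain[symmetric] by (subst compactin_PiE) auto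
  then have "compact Q" unfolding euclidean_product_topology by simp
  moreover have "closed L"
    unfolding L_def by (intro closed_Collect_conj closed_Collect_all closed_Collect_eq continuous_intros) auto
  ultimately have "compact (Q \<inter> L)" by (rule compact_Int_closed)
  have bound: "\<bar>g (i,e)\<bar> \<le> r * norm e" if "g \<in> Q" for g i e
  proof -
    have "g (i,e) \<in> {- r * norm e .. r * norm e}" using Pi_mem[OF that[unfolded Q_def], of "(i,e)"] by simp
    then show ?thesis by auto
  qed
  define W where "W a = (\<Inter>i<m. {g :: nat \<times> 'e \<Rightarrow> real. g (i,a) < 1})" for a
  have opW: "open (W a)" for a
    unfolding W_def by (intro open_INT ballI open_Collect_less continuous_intros) auto
  have covW: "\<exists>a\<in>A. g \<in> W a" if g: "g \<in> Q \<inter> L" for g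
  proof -
    have bl: "bounded_linear (\<lambda>e. g (i,e))" for i
      by (rule bounded_linear_intro[of _ r])
        (use g bound in \<open>auto simp: L_def mult.commute\<close>)
    define \<phi> where "\<phi> i = Blinfun (\<lambda>e. g (i,e))" for i
    have ap: "blinfun_apply (\<phi> i) e = g (i,e)" for i e
      unfolding \<phi>_def by (simp add: bounded_linear_Blinfun_apply[OF bl])
    have "norm (\<phi> i) \<le> r" for i
      by (rule norm_blinfun_bound[OF r]) (use bound g in \<open>auto simp: ap\<close>)
    from cover[of \<phi>, OF this] show ?thesis by (auto simp: W_def ap)
  qed
  obtain A0 where A0: "A0 \<subseteq> A" "finite A0" "Q \<inter> L \<subseteq> (\<Union>a\<in>A0. W a)"
  proof (rule compactE_image[OF \<open>compact (Q \<inter> L)\<close>])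
    show "Q \<inter> L \<subseteq> (\<Union>a\<in>A. W a)" using covW by blast
  qed (use opW in auto)
  show ?thesis
  proof (intro exI conjI allI impI)
    show "finite A0" "A0 \<subseteq> A" by (fact A0)+
    fix \<phi> :: "nat \<Rightarrow> 'e \<Rightarrow>\<^sub>L real" assume n: "\<forall>i. norm (\<phi> i) \<le> r"
    define g where "g = (\<lambda>(i,e). \<phi> i e)"
    have "\<bar>\<phi> i e\<bar> \<le> r * norm e" for i e
    proof -
      have "\<bar>\<phi> i e\<bar> \<le> norm (\<phi> i) * norm e" using norm_blinfun[of "\<phi> i" e] by simp
      also have "\<dots> \<le> r * norm e" using n by (intro mult_right_mono) auto
      finally show ?thesis .
    qed
    then have "g \<in> Q" unfolding Q_def g_def by (auto simp: abs_le_iff minus_le_iff)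
    moreover have "g \<in> L" unfolding L_def g_def by (auto simp: blinfun.add_right blinfun.scaleR_right)
    ultimately obtain a where "a \<in> A0" "g \<in> W a" using A0(3) by blast
    then show "\<exists>a\<in>A0. \<forall>i<m. blinfun_apply (\<phi> i) a < 1" unfolding W_def g_def by auto
  qed
qed

text \<open>One number \<open>m\<close> bounds both how many functionals are tested and their norms,
  so that countably many classes, each open to a compactness argument, cover all finite sets of
  functionals. Tuples are padded with zeros.\<close>

lemma finite_functionals_as_tuple:
  fixes F :: "('e::real_normed_vector \<Rightarrow>\<^sub>L real) set"
  assumes "finite F"
  obtains m :: nat and \<phi> :: "nat \<Rightarrow> 'e \<Rightarrow>\<^sub>L real" where
    "\<forall>i. norm (\<phi> i) \<le> m" "\<forall>e. (\<forall>i<m. blinfun_apply (\<phi> i) e < 1) \<longrightarrow> (\<forall>\<psi>\<in>F. blinfun_apply \<psi> e < 1)"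
proof -
  obtain xs where xs: "set xs = F" using assms finite_list by blast
  define \<phi> where "\<phi> i = (if i < length xs then xs ! i else 0)" for i
  obtain N :: nat where N: "(\<Sum>\<psi>\<in>F. norm \<psi>) \<le> real N" using real_arch_simple by blast
  have "norm \<psi> \<le> real N" if "\<psi> \<in> F" for \<psi>
    using member_le_sum[OF that, of norm] assms N by auto
  then have "norm (\<phi> i) \<le> real (max N (length xs))" for i
    using xs unfolding \<phi>_def by (auto simp: of_nat_max le_max_iff_disj)
  moreover have "blinfun_apply \<psi> e < 1"
    if "\<forall>i<max N (length xs). blinfun_apply (\<phi> i) e < 1" "\<psi> \<in> F" for e \<psi>
  proof -
    obtain i where "i < length xs" "\<psi> = \<phi> i" using \<open>\<psi> \<in> F\<close> xs unfolding \<phi>_def by (metis in_set_conv_nth)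
    then show ?thesis using that(1) by auto
  qed
  ultimately show thesis using that by blast
qed

text \<open>Kaplansky's theorem, at the origin. The one-sided inequalities lose nothing since \<open>F\<close> may be symmetric.\<close>

lemma weak_countable_tightness:
  fixes A :: "'e::real_normed_vector set"
  assumes "\<And>F :: ('e \<Rightarrow>\<^sub>L real) set. finite F \<Longrightarrow> \<exists>a\<in>A. \<forall>\<phi>\<in>F. blinfun_apply \<phi> a < 1"
  obtains A' where "countable A'" "A' \<subseteq> A"
    "\<And>F :: ('e \<Rightarrow>\<^sub>L real) set. finite F \<Longrightarrow> \<exists>a\<in>A'. \<forall>\<phi>\<in>F. blinfun_apply \<phi> a < 1"
proof -
  have "\<exists>A0. finite A0 \<and> A0 \<subseteq> A \<and> (\<forall>\<phi> :: nat \<Rightarrow> 'e \<Rightarrow>\<^sub>L real. (\<forall>i. norm (\<phi> i) \<le> real m) \<longrightarrow>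
      (\<exists>a\<in>A0. \<forall>i<m. blinfun_apply (\<phi> i) a < 1))" for m
  proof -
    have "\<exists>a\<in>A. \<forall>i<m. blinfun_apply (\<phi> i) a < 1" for \<phi> :: "nat \<Rightarrow> 'e \<Rightarrow>\<^sub>L real"
      using assms[of "\<phi> ` {..<m}"] by auto
    then show ?thesis by (intro finitely_many_vectors_for_bounded_tuples) auto
  qed
  \<comment> \<open>Compactness replaces the choices for single tuples by one finite set
    \<open>D m\<close> for all \<open>m\<close>-tuples bounded by \<open>m\<close>; the countable
    union of these sets answers every \<open>F\<close>.\<close>
  then obtain D where D: "\<And>m. finite (D m)" "\<And>m. D m \<subseteq> A"
    "\<And>m (\<phi> :: nat \<Rightarrow> 'e \<Rightarrow>\<^sub>L real). (\<forall>i. norm (\<phi> i) \<le> real m) \<Longrightarrow> \<exists>a\<in>D m. \<forall>i<m. blinfun_apply (\<phi> i) a < 1"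
    by metis
  show thesis
  proof
    show "countable (\<Union>m. D m)" using D(1) by (intro countable_UN) (auto intro: countable_finite)
    show "(\<Union>m. D m) \<subseteq> A" using D(2) by blast
    fix F :: "('e \<Rightarrow>\<^sub>L real) set" assume "finite F"
    then obtain m :: nat and \<phi> :: "nat \<Rightarrow> 'e \<Rightarrow>\<^sub>L real" where \<phi>: "\<forall>i. norm (\<phi> i) \<le> real m"
      "\<forall>e. (\<forall>i<m. blinfun_apply (\<phi> i) e < 1) \<longrightarrow> (\<forall>\<psi>\<in>F. blinfun_apply \<psi> e < 1)"
      by (rule finite_functionals_as_tuple)
    from D(3)[OF \<phi>(1)] \<phi>(2) show "\<exists>a\<in>(\<Union>m. D m). \<forall>\<phi>\<in>F. blinfun_apply \<phi> a < 1" by blast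
  qed
qed

subsection \<open>Independent sequences and copies of the space of summable sequences\<close>

text \<open>Indices \<open>i\<close> are colours. If no colour worked, each colour would be defeated by finitely many pieces
  inside any given piece; iterating over all colours gives finitely many pieces none of which is split in any
  colour, contradicting the separation hypothesis.\<close>

lemma exists_independent_sequence:
  fixes hi lo :: "'y \<Rightarrow> 'i \<Rightarrow> 'f \<Rightarrow> bool"
  assumes "uncountable Y" "countable F" "finite I"
    and sep: "\<And>P. finite P \<Longrightarrow> P \<subseteq> Y \<Longrightarrow> \<exists>A. finite A \<and>
      (\<forall>Q. finite Q \<and> Q \<subseteq> Y - A \<longrightarrow>
        (\<exists>f\<in>F. (\<forall>p\<in>P. \<forall>i\<in>I. lo p i f) \<and> (\<forall>q\<in>Q. \<exists>i\<in>I. hi q i f)))"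
  shows "\<exists>i\<in>I. \<exists>f :: nat \<Rightarrow> 'f. (\<forall>k. f k \<in> F) \<and>
    (\<forall>n s. \<exists>y\<in>Y. \<forall>k<n. if s k then hi y i (f k) else lo y i (f k))"
proof -
  define \<D> where "\<D> = (\<Union>i\<in>I. \<Union>f\<in>F. {{y. hi y i f}, {y. lo y i f}})"
  have "countable \<D>"
    unfolding \<D>_def using assms(2,3) by (intro countable_UN) (auto simp: countable_finite)
  define \<N> where "\<N> = {\<G>. finite \<G> \<and> \<G> \<subseteq> \<D>}"
  have "countable \<N>"
    unfolding \<N>_def using countable_Collect_finite_subset[OF \<open>countable \<D>\<close>] by (simp add: conj_commute)
  \<comment> \<open>\<open>bad\<close> collects every countable intersection of \<open>Y\<close>
    with finitely many constraint sets. There are only countably many constraint patterns, so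
    \<open>bad\<close> is countable, and a pattern still met outside \<open>bad\<close> is met
    uncountably often.\<close>
  define bad where "bad = (\<Union>\<G>\<in>{\<G>\<in>\<N>. countable (Y \<inter> \<Inter>\<G>)}. Y \<inter> \<Inter>\<G>)"
  have "countable bad"
    unfolding bad_def using \<open>countable \<N>\<close> by (intro countable_UN countable_Collect) auto
  define \<C> where "\<C> = (\<lambda>\<G>. (Y \<inter> \<Inter>\<G>) - bad) ` \<N> - {{}}"
  have inf: "infinite W" if W: "W \<in> \<C>" for W
  proof -
    obtain \<G> where \<G>: "\<G> \<in> \<N>" "W = (Y \<inter> \<Inter>\<G>) - bad" "W \<noteq> {}"
      using W unfolding \<C>_def by blast
    then have "uncountable (Y \<inter> \<Inter>\<G>)" unfolding bad_def by blast
    then have "uncountable W"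
      unfolding \<G>(2) using \<open>countable bad\<close> by (rule uncountable_minus_countable)
    then show ?thesis using countable_finite by blast
  qed
  have subY: "W \<subseteq> Y" "W \<noteq> {}" if "W \<in> \<C>" for W
    using that unfolding \<C>_def by auto
  have Int_in: "W \<inter> D \<in> \<C>" if W: "W \<in> \<C>" and "D \<in> \<D>" "W \<inter> D \<noteq> {}" for W D
  proof -
    obtain \<G> where \<G>: "\<G> \<in> \<N>" "W = (Y \<inter> \<Inter>\<G>) - bad" using W unfolding \<C>_def by blast
    then have "insert D \<G> \<in> \<N>" "W \<inter> D = (Y \<inter> \<Inter>(insert D \<G>)) - bad"
      using that unfolding \<N>_def by auto
    then show ?thesis using that(3) unfolding \<C>_def by blast
  qed
  have "Y - bad \<noteq> {}"
    using uncountable_minus_countable[OF assms(1) \<open>countable bad\<close>] by (metis countable_empty)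
  then have top: "Y - bad \<in> \<C>"
    unfolding \<C>_def \<N>_def by (auto intro!: image_eqI[of _ _ "{}"])
  define split where "split i f W \<longleftrightarrow> (\<exists>y\<in>W. hi y i f) \<and> (\<exists>y\<in>W. lo y i f)" for i f W
  have split_mono: "split i f W \<Longrightarrow> W \<subseteq> W' \<Longrightarrow> split i f W'" for i f W W'
    unfolding split_def by blast
  define good where "good W0 \<W> \<longleftrightarrow> finite \<W> \<and> \<W> \<subseteq> \<C> \<and> (\<forall>W\<in>\<W>. W \<subseteq> W0)" for W0 \<W>
  \<comment> \<open>The order of quantifiers matters: one fixed colour must work for every finite
    family of pieces below \<open>W0\<close>, since each stage of the construction splits all
    current pieces with a single \<open>f\<close>.\<close>
  have "\<exists>i\<in>I. \<exists>W0\<in>\<C>. \<forall>\<W>. good W0 \<W> \<longrightarrow> (\<exists>f\<in>F. \<forall>W\<in>\<W>. split i f W)"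
  proof (rule ccontr)
    assume asm: "\<not> ?thesis"
    have neg: "\<forall>i\<in>I. \<forall>W0\<in>\<C>. \<exists>\<W>. good W0 \<W> \<and> (\<forall>f\<in>F. \<exists>W\<in>\<W>. \<not> split i f W)"
      using asm by simp
    \<comment> \<open>Induction on the set \<open>J\<close> of defeated colours: inside each piece
      that helps to defeat \<open>J\<close> a family defeating \<open>j\<close> is placed. By
      \<open>split_mono\<close> a piece inherits all failures of the pieces containing it.\<close>
    have "\<exists>\<W>. good W0 \<W> \<and> (\<forall>f\<in>F. \<exists>W\<in>\<W>. \<forall>i\<in>J. \<not> split i f W)"
      if "J \<subseteq> I" "W0 \<in> \<C>" for J W0
      using finite_subset[OF that(1) assms(3)] that
    proof (induction J arbitrary: W0 rule: finite_induct)
      case empty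
      then show ?case by (intro exI[of _ "{W0}"]) (auto simp: good_def)
    next
      case (insert j J)
      then obtain \<W> where W: "good W0 \<W>" "\<forall>f\<in>F. \<exists>W\<in>\<W>. \<forall>i\<in>J. \<not> split i f W"
        by (meson insert_subset)
      have "j \<in> I" "\<W> \<subseteq> \<C>" using W(1) insert.prems by (auto simp: good_def)
      have "\<exists>\<V>. good W \<V> \<and> (\<forall>f\<in>F. \<exists>V\<in>\<V>. \<not> split j f V)" if "W \<in> \<W>" for W
        using that \<open>\<W> \<subseteq> \<C>\<close> by (intro neg[rule_format, OF \<open>j \<in> I\<close>]) auto
      then obtain \<V> where V: "\<And>W. W \<in> \<W> \<Longrightarrow> good W (\<V> W)"
        "\<And>W f. W \<in> \<W> \<Longrightarrow> f \<in> F \<Longrightarrow> \<exists>V\<in>\<V> W. \<not> split j f V"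
        by metis
      have "V \<in> \<C> \<and> V \<subseteq> W0" if "W \<in> \<W>" "V \<in> \<V> W" for W V
        using V(1)[OF that(1)] W(1) that unfolding good_def by (meson subset_trans subsetD)
      then have "good W0 (\<Union>W\<in>\<W>. \<V> W)" using V(1) W(1) by (auto simp: good_def)
      moreover have "\<exists>V\<in>(\<Union>W\<in>\<W>. \<V> W). \<forall>i\<in>insert j J. \<not> split i f V" if f: "f \<in> F" for f
      proof -
        obtain W where 1: "W \<in> \<W>" "\<forall>i\<in>J. \<not> split i f W" using W(2) f by blast
        obtain V where "V \<in> \<V> W" "\<not> split j f V" "V \<subseteq> W"
          using V(1)[OF 1(1)] V(2)[OF 1(1) f] unfolding good_def by metis
        then show ?thesis using split_mono 1 by blast
      qed
      ultimately show ?case by blast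
    qed
    from this[OF subset_refl top] obtain \<W> where
      gW: "good (Y - bad) \<W>" and unsplit: "\<forall>f\<in>F. \<exists>W\<in>\<W>. \<forall>i\<in>I. \<not> split i f W"
      by (elim exE conjE)
    have W: "finite \<W>" "\<And>W. W \<in> \<W> \<Longrightarrow> W \<in> \<C>" using gW by (auto simp: good_def)
    \<comment> \<open>Separation is applied to one point \<open>p W\<close> of each piece and a
      second point \<open>q W\<close> off the exceptional set, which exists as pieces are infinite.
      The resulting \<open>f\<close> is low at \<open>p W\<close> in all colours and high at
      \<open>q W\<close> in some colour, so it splits every piece.\<close>
    have "\<forall>W\<in>\<W>. \<exists>y. y \<in> W" using W(2) subY(2) by (meson ex_in_conv)
    then obtain p where p: "\<And>W. W \<in> \<W> \<Longrightarrow> p W \<in> W" by metis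
    then have "finite (p ` \<W>)" "p ` \<W> \<subseteq> Y" using W subY(1) by auto
    from sep[OF this] obtain A where A: "finite A"
      "\<And>Q. finite Q \<Longrightarrow> Q \<subseteq> Y - A \<Longrightarrow> \<exists>f\<in>F. (\<forall>p\<in>p ` \<W>. \<forall>i\<in>I. lo p i f) \<and> (\<forall>q\<in>Q. \<exists>i\<in>I. hi q i f)"
      by metis
    have "\<exists>q. q \<in> W - A" if "W \<in> \<W>" for W
      using Diff_infinite_finite[OF A(1) inf[OF W(2)[OF that]]] by (metis ex_in_conv finite.emptyI)
    then obtain q where q: "\<And>W. W \<in> \<W> \<Longrightarrow> q W \<in> W - A" by metis
    then have "q ` \<W> \<subseteq> Y - A" using W(2) subY(1) by auto
    from A(2)[OF finite_imageI[OF W(1)] this] obtain f where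
      f: "f \<in> F" "\<forall>W\<in>\<W>. \<forall>i\<in>I. lo (p W) i f" "\<forall>W\<in>\<W>. \<exists>i\<in>I. hi (q W) i f" by auto
    obtain W where "W \<in> \<W>" "\<forall>i\<in>I. \<not> split i f W" using unsplit f(1) by blast
    then show False using f(2,3) p[of W] q[of W] unfolding split_def by blast
  qed
  then obtain i W0 where i: "i \<in> I" and W0: "W0 \<in> \<C>"
    and ex: "\<And>\<W>. good W0 \<W> \<Longrightarrow> \<exists>f\<in>F. \<forall>W\<in>\<W>. split i f W"
    by blast
  \<comment> \<open>Each stage replaces every piece by its two nonempty halves, so that stage
    \<open>n\<close> contains a piece for every high-low pattern of length \<open>n\<close>.\<close>
  define child where "child f \<W> = (\<Union>W\<in>\<W>. {W \<inter> {y. hi y i f}, W \<inter> {y. lo y i f}})" for f \<W>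
  have "\<exists>g. \<forall>n. (good W0 (snd (g n)) \<and> (n = 0 \<longrightarrow> snd (g n) = {W0})) \<and>
      (fst (g (Suc n)) \<in> F \<and> snd (g (Suc n)) = child (fst (g (Suc n))) (snd (g n)))"
  proof (rule dependent_nat_choice)
    show "\<exists>x. good W0 (snd x) \<and> (0 = (0::nat) \<longrightarrow> snd x = {W0})"
      using W0 by (auto simp: good_def)
  next
    fix x :: "'f \<times> 'y set set" and n :: nat
    assume "good W0 (snd x) \<and> (n = 0 \<longrightarrow> snd x = {W0})"
    then have g: "good W0 (snd x)" by simp
    from ex[OF this] obtain f where f: "f \<in> F" "\<And>W. W \<in> snd x \<Longrightarrow> split i f W" by metis
    have D: "{y. hi y i f} \<in> \<D>" "{y. lo y i f} \<in> \<D>" using f(1) i unfolding \<D>_def by blast+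
    have "W \<inter> {y. hi y i f} \<in> \<C>" "W \<inter> {y. lo y i f} \<in> \<C>" "W \<subseteq> W0" if "W \<in> snd x" for W
    proof -
      have W: "W \<in> \<C>" "W \<subseteq> W0" using that g by (auto simp: good_def)
      have "W \<inter> {y. hi y i f} \<noteq> {}" "W \<inter> {y. lo y i f} \<noteq> {}"
        using f(2)[OF that] unfolding split_def by blast+
      then show "W \<inter> {y. hi y i f} \<in> \<C>" "W \<inter> {y. lo y i f} \<in> \<C>" "W \<subseteq> W0"
        using W D by (auto intro: Int_in)
    qed
    then have "good W0 (child f (snd x))"
      using g unfolding good_def child_def by auto
    then show "\<exists>y. (good W0 (snd y) \<and> (Suc n = 0 \<longrightarrow> snd y = {W0})) \<and> fst y \<in> F \<and> snd y = child (fst y) (snd x)"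
      using f(1) by (intro exI[of _ "(f, child f (snd x))"]) auto
  qed
  then obtain g where g: "\<And>n. good W0 (snd (g n))" "snd (g 0) = {W0}" "\<And>n. fst (g (Suc n)) \<in> F"
    "\<And>n. snd (g (Suc n)) = child (fst (g (Suc n))) (snd (g n))" by metis
  \<comment> \<open>The first component of \<open>g 0\<close> is arbitrary, so the sequence starts
    at \<open>g 1\<close>.\<close>
  define f where "f k = fst (g (Suc k))" for k
  have *: "\<exists>W\<in>snd (g n). \<forall>k<n. \<forall>y\<in>W. if s k then hi y i (f k) else lo y i (f k)" for s n
  proof (induction n)
    case 0
    then show ?case using g(2) by auto
  next
    case (Suc n)
    then obtain W where W: "W \<in> snd (g n)" "\<forall>k<n. \<forall>y\<in>W. if s k then hi y i (f k) else lo y i (f k)" by blast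
    define V where "V = W \<inter> (if s n then {y. hi y i (f n)} else {y. lo y i (f n)})"
    have "V \<in> snd (g (Suc n))" using W(1) unfolding g(4) child_def V_def f_def by auto
    moreover have "\<forall>k<Suc n. \<forall>y\<in>V. if s k then hi y i (f k) else lo y i (f k)"
      using W(2) by (auto simp: V_def less_Suc_eq)
    ultimately show ?case by blast
  qed
  show ?thesis
  proof (intro bexI[OF _ i] exI conjI allI)
    show "f k \<in> F" for k unfolding f_def by (rule g(3))
    show "\<exists>y\<in>Y. \<forall>k<n. if s k then hi y i (f k) else lo y i (f k)" for n s
    proof -
      obtain W where W: "W \<in> snd (g n)" "\<forall>k<n. \<forall>y\<in>W. if s k then hi y i (f k) else lo y i (f k)"
        using * by blast
      then have "W \<in> \<C>" using g(1) unfolding good_def by blast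
      then obtain y where "y \<in> W" "y \<in> Y" using subY by blast
      then show ?thesis using W(2) by blast
    qed
  qed
qed

section \<open>Closed copies of \<open>ell1\<close>\<close>

lemma ell1_diff: "x \<in> ell1 \<Longrightarrow> y \<in> ell1 \<Longrightarrow> (\<lambda>n. x n - y n) \<in> ell1"
  unfolding ell1_def mem_Collect_eq
  by (rule summable_comparison_test'[OF summable_add[of "\<lambda>n. \<bar>x n\<bar>" "\<lambda>n. \<bar>y n\<bar>"], of 0]) auto

text \<open>The estimates make \<open>e\<close> equivalent to the unit vector basis, and
  \<open>T\<close> sums the corresponding series. The range is closed because summable sequences are
  complete, which is proved coordinatewise.\<close>

lemma contains_ell1_if_lower_estimate:
  fixes e :: "nat \<Rightarrow> 'e::banach"
  assumes c: "c > 0" and M: "\<And>k. norm (e k) \<le> M"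
    and low: "\<And>n a. c * (\<Sum>k<n. \<bar>a k\<bar>) \<le> norm (\<Sum>k<n. a k *\<^sub>R e k)"
  shows "contains_closed_copy_of_ell1 TYPE('e)"
proof -
  define T where "T x = (\<Sum>k. x k *\<^sub>R e k)" for x
  \<comment> \<open>The summand 1 makes the upper constant strictly positive.\<close>
  define C where "C = M + 1"
  have C: "C > 0" "\<And>k. norm (e k) \<le> C"
    using M[of 0] norm_ge_zero[of "e 0"] M unfolding C_def
    by (linarith, simp add: add_increasing2)
  have sn: "summable (\<lambda>k. norm (x k *\<^sub>R e k))" if "x \<in> ell1" for x
    by (rule summable_comparison_test'[OF summable_mult2[of "\<lambda>n. \<bar>x n\<bar>" C], of 0])
      (use that C in \<open>auto simp: ell1_def mult_left_mono\<close>)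
  have T: "(\<lambda>k. x k *\<^sub>R e k) sums T x" if "x \<in> ell1" for x
    unfolding T_def using summable_norm_cancel[OF sn[OF that]] by (rule summable_sums)
  have N: "(\<lambda>k. \<bar>x k\<bar>) sums ell1_norm x" if "x \<in> ell1" for x
    using that unfolding ell1_def ell1_norm_def by (auto intro: summable_sums)
  have Tadd: "T (\<lambda>n. x n + y n) = T x + T y" if "x \<in> ell1" "y \<in> ell1" for x y
    using sums_add[OF T[OF that(1)] T[OF that(2)]] unfolding T_def
    by (simp add: scaleR_add_left sums_iff)
  have Tscale: "T (\<lambda>n. a * x n) = a *\<^sub>R T x" if "x \<in> ell1" for x a
    using sums_scaleR_right[OF T[OF that], of a] unfolding T_def by (simp add: sums_iff)
  have Tdiff: "T (\<lambda>n. x n - y n) = T x - T y" if "x \<in> ell1" "y \<in> ell1" for x y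
    using sums_diff[OF T[OF that(1)] T[OF that(2)]] unfolding T_def
    by (simp add: scaleR_diff_left sums_iff)
  have Tlow: "c * ell1_norm x \<le> norm (T x)" if "x \<in> ell1" for x
  proof (rule LIMSEQ_le)
    show "(\<lambda>n. c * (\<Sum>k<n. \<bar>x k\<bar>)) \<longlonglongrightarrow> c * ell1_norm x"
      using N[OF that] unfolding sums_def by (intro tendsto_intros)
    show "(\<lambda>n. norm (\<Sum>k<n. x k *\<^sub>R e k)) \<longlonglongrightarrow> norm (T x)"
      using T[OF that] unfolding sums_def by (intro tendsto_intros)
  qed (use low in auto)
  have Tup: "norm (T x) \<le> C * ell1_norm x" if "x \<in> ell1" for x
  proof -
    have "norm (T x) \<le> (\<Sum>k. norm (x k *\<^sub>R e k))"
      unfolding T_def by (rule summable_norm[OF sn[OF that]])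
    also have "\<dots> \<le> (\<Sum>k. \<bar>x k\<bar> * C)"
      using that C by (intro suminf_le sn[OF that] summable_mult2) (auto simp: ell1_def mult_left_mono)
    also have "\<dots> = C * ell1_norm x"
      using sums_mult2[OF N[OF that], of C] by (simp add: sums_iff mult.commute)
    finally show ?thesis .
  qed
  have N0: "x k = 0" if "x \<in> ell1" "ell1_norm x \<le> 0" for x k
    using N[OF that(1)] that(2) suminf_eq_zero_iff[of "\<lambda>k. \<bar>x k\<bar>"] suminf_nonneg[of "\<lambda>k. \<bar>x k\<bar>"]
    by (auto simp: sums_iff)
  have inj: "inj_on T ell1"
  proof (rule inj_onI)
    fix x y assume xy: "x \<in> ell1" "y \<in> ell1" "T x = T y"
    have d: "(\<lambda>n. x n - y n) \<in> ell1" using xy ell1_diff by blast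
    have "c * ell1_norm (\<lambda>n. x n - y n) \<le> 0" using Tlow[OF d] Tdiff xy by simp
    then have "ell1_norm (\<lambda>n. x n - y n) \<le> 0" using c by (simp add: mult_le_0_iff)
    from N0[OF d this] show "x = y" by auto
  qed
  have sub: "subspace (T ` ell1)"
  proof (rule subspaceI)
    have z: "(\<lambda>_. 0) \<in> ell1" by (simp add: ell1_def)
    have "T (\<lambda>_. 0) = 0" by (simp add: T_def)
    with z show "0 \<in> T ` ell1" by (metis image_eqI)
    show "u + v \<in> T ` ell1" if uv: "u \<in> T ` ell1" "v \<in> T ` ell1" for u v
    proof -
      obtain x y where xy: "x \<in> ell1" "y \<in> ell1" "u = T x" "v = T y" using uv by blast
      have "(\<lambda>n. x n - (\<lambda>n. 0 - y n) n) \<in> ell1" by (intro ell1_diff z xy)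
      then have "(\<lambda>n. x n + y n) \<in> ell1" by simp
      then show ?thesis unfolding xy(3,4) Tadd[OF xy(1,2), symmetric] by (rule imageI)
    qed
    show "a *\<^sub>R u \<in> T ` ell1" if u: "u \<in> T ` ell1" for a u
    proof -
      obtain x where x: "x \<in> ell1" "u = T x" using u by blast
      have "(\<lambda>n. a * x n) \<in> ell1" using x(1) by (auto simp: ell1_def abs_mult intro: summable_mult)
      then show ?thesis unfolding x(2) Tscale[OF x(1), symmetric] by (rule imageI)
    qed
  qed
  have "closed (T ` ell1)"
    unfolding closed_sequential_limits
  proof (intro allI impI, elim conjE)
    fix u v assume "\<forall>n. u n \<in> T ` ell1" and uv: "u \<longlonglongrightarrow> v"
    then have "\<forall>j. \<exists>x. x \<in> ell1 \<and> u j = T x" by blast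
    then obtain x where x: "\<And>j. x j \<in> ell1" "\<And>j. u j = T (x j)" by metis
    have part: "c * (\<Sum>k<n. \<bar>x j k - x i k\<bar>) \<le> norm (u j - u i)" for n i j
    proof -
      have d: "(\<lambda>n. x j n - x i n) \<in> ell1" by (intro ell1_diff x)
      have "(\<Sum>k<n. \<bar>x j k - x i k\<bar>) \<le> ell1_norm (\<lambda>n. x j n - x i n)"
        unfolding ell1_norm_def using d by (intro sum_le_suminf) (auto simp: ell1_def)
      then have "c * (\<Sum>k<n. \<bar>x j k - x i k\<bar>) \<le> c * ell1_norm (\<lambda>n. x j n - x i n)" using c by simp
      also have "\<dots> \<le> norm (u j - u i)" using Tlow[OF d] Tdiff x by simp
      finally show ?thesis .
    qed
    have pt: "\<bar>x j k - x i k\<bar> \<le> norm (u j - u i) / c" for i j k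
    proof -
      have "\<bar>x j k - x i k\<bar> \<le> (\<Sum>k<Suc k. \<bar>x j k - x i k\<bar>)" by (simp add: sum_nonneg)
      then have "c * \<bar>x j k - x i k\<bar> \<le> c * (\<Sum>k<Suc k. \<bar>x j k - x i k\<bar>)" using c by (intro mult_left_mono) auto
      also have "\<dots> \<le> norm (u j - u i)" by (rule part)
      finally show ?thesis using c by (simp add: field_simps)
    qed
    have "Cauchy u" using uv by (auto intro: LIMSEQ_imp_Cauchy)
    have "Cauchy (\<lambda>j. x j k)" for k
    proof (rule metric_CauchyI)
      fix \<epsilon> :: real assume "\<epsilon> > 0"
      then obtain n where n: "\<And>i j. i \<ge> n \<Longrightarrow> j \<ge> n \<Longrightarrow> norm (u j - u i) < c * \<epsilon>"
        using \<open>Cauchy u\<close> c unfolding Cauchy_def dist_norm by (metis mult_pos_pos)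
      show "\<exists>M. \<forall>m\<ge>M. \<forall>n\<ge>M. dist (x m k) (x n k) < \<epsilon>"
      proof (intro exI allI impI)
        fix i j assume "i \<ge> n" "j \<ge> n"
        then have "norm (u i - u j) / c < \<epsilon>" using n c by (simp add: field_simps)
        then show "dist (x i k) (x j k) < \<epsilon>" using pt[of i k j] unfolding dist_real_def by linarith
      qed
    qed
    then have "\<forall>k. \<exists>l. (\<lambda>j. x j k) \<longlonglongrightarrow> l" using Cauchy_convergent convergent_def by blast
    then obtain z where z: "\<And>k. (\<lambda>j. x j k) \<longlonglongrightarrow> z k" by metis
    \<comment> \<open>Passing to the limit in partial sums gives a bound uniform in
      \<open>n\<close>, hence both membership of \<open>x j - z\<close> in \<open>ell1\<close> and
      smallness of its norm.\<close>
    have lim: "c * (\<Sum>k<n. \<bar>x j k - z k\<bar>) \<le> norm (u j - v)" for n j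
    proof (rule LIMSEQ_le)
      show "(\<lambda>i. c * (\<Sum>k<n. \<bar>x j k - x i k\<bar>)) \<longlonglongrightarrow> c * (\<Sum>k<n. \<bar>x j k - z k\<bar>)"
        using z by (intro tendsto_intros)
      show "(\<lambda>i. norm (u j - u i)) \<longlonglongrightarrow> norm (u j - v)" using uv by (intro tendsto_intros)
    qed (use part in auto)
    have lim': "(\<Sum>k<n. \<bar>x j k - z k\<bar>) \<le> norm (u j - v) / c" for n j
      using lim[where n=n and j=j] c by (simp add: field_simps)
    have d: "(\<lambda>k. x j k - z k) \<in> ell1" for j
      unfolding ell1_def mem_Collect_eq
      using lim'[of _ "Suc _"] by (intro bounded_imp_summable[where B="norm (u j - v) / c"]) (auto simp: lessThan_Suc_atMost)
    have "(\<lambda>k. x 0 k - (\<lambda>k. x 0 k - z k) k) \<in> ell1" by (intro ell1_diff x d)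
    then have zl: "z \<in> ell1" by simp
    have "norm (u j - T z) \<le> C * (norm (u j - v) / c)" for j
    proof -
      have "norm (u j - T z) \<le> C * ell1_norm (\<lambda>k. x j k - z k)"
        using Tup[OF d[of j]] Tdiff[OF x(1) zl] x(2) by simp
      also have "ell1_norm (\<lambda>k. x j k - z k) \<le> norm (u j - v) / c"
        unfolding ell1_norm_def using d[of j] lim' by (intro suminf_le_const) (auto simp: ell1_def)
      finally show ?thesis using C by simp
    qed
    moreover have "(\<lambda>j. C * (norm (u j - v) / c)) \<longlonglongrightarrow> C * (norm (v - v) / c)"
      using uv c by (intro tendsto_intros) auto
    ultimately have "(\<lambda>j. u j - T z) \<longlonglongrightarrow> 0"
      by (intro Lim_null_comparison[of "\<lambda>j. u j - T z"]) auto
    then have "u \<longlonglongrightarrow> T z" by (simp add: LIM_zero_iff)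
    then have "v = T z" using uv LIMSEQ_unique by blast
    then show "v \<in> T ` ell1" using zl by blast
  qed
  with sub inj Tadd Tscale Tlow Tup c C(1) show ?thesis
    unfolding contains_closed_copy_of_ell1_def
    by (intro exI[of _ "T ` ell1"] exI[of _ T] exI[of _ c] exI[of _ C])
      (auto simp: inj_on_imp_bij_betw)
qed

subsection \<open>Topological preliminaries\<close>

lemma common_convergent_subsequence:
  fixes v :: "'i \<Rightarrow> nat \<Rightarrow> real"
  assumes "finite I" "\<And>i. i \<in> I \<Longrightarrow> Bseq (v i)"
  obtains r where "strict_mono (r :: nat \<Rightarrow> nat)" "\<And>i. i \<in> I \<Longrightarrow> convergent (\<lambda>k. v i (r k))"
proof -
  have "\<exists>r :: nat \<Rightarrow> nat. strict_mono r \<and> (\<forall>i\<in>I. convergent (\<lambda>k. v i (r k)))"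
    using assms
  proof (induction I rule: finite_induct)
    case empty
    then show ?case by (intro exI[of _ id]) (auto simp: strict_mono_def)
  next
    case (insert i I)
    then obtain r :: "nat \<Rightarrow> nat" where r: "strict_mono r" "\<And>i. i \<in> I \<Longrightarrow> convergent (\<lambda>k. v i (r k))" by auto
    have "bounded (range (\<lambda>k. v i (r k)))"
      using insert.prems[of i] by (auto simp: Bseq_eq_bounded intro: bounded_subset)
    then obtain l s where s: "strict_mono (s :: nat \<Rightarrow> nat)" "((\<lambda>k. v i (r k)) \<circ> s) \<longlonglongrightarrow> l"
      using bounded_imp_convergent_subsequence by blast
    have "convergent (\<lambda>k. v j (r (s k)))" if "j \<in> I" for j
      using convergent_subseq_convergent[OF r(2)[OF that] s(1)] by (simp add: o_def)
    with s r(1) show ?case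
      by (intro exI[of _ "r \<circ> s"]) (auto simp: strict_mono_def convergent_def comp_def)
  qed
  then show thesis using that by blast
qed

text \<open>The points without a neighbourhood of countable image form a closed set, which has no isolated point:
  deleting the fibre of an isolated one leaves countably many compact sets of countable image.\<close>

lemma compact_scattered_countable_image:
  fixes h :: "'a \<Rightarrow> 'b::metric_space"
  assumes "regular_space X" "compactin X K" "scattered_in X K" "continuous_map X euclidean h"
  shows "countable (h ` K)"
proof -
  define S where "S = \<Union>{V. openin X V \<and> countable (h ` (V \<inter> K))}"
  have compact_in_S: "countable (h ` C)" if C: "compactin X C" "C \<subseteq> S" "C \<subseteq> K" for C
  proof -
    obtain \<V> where V: "finite \<V>" "\<V> \<subseteq> {V. openin X V \<and> countable (h ` (V \<inter> K))}" "C \<subseteq> \<Union>\<V>"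
      using compactinD[OF C(1), of "{V. openin X V \<and> countable (h ` (V \<inter> K))}"] C(2) unfolding S_def by blast
    have "h ` C \<subseteq> (\<Union>V\<in>\<V>. h ` (V \<inter> K))" using V(3) C(3) by blast
    moreover have "countable (\<Union>V\<in>\<V>. h ` (V \<inter> K))" using V by (intro countable_UN) (auto simp: countable_finite)
    ultimately show ?thesis by (rule countable_subset)
  qed
  have "K \<subseteq> S"
  proof (rule ccontr)
    assume "\<not> ?thesis"
    then have "K - S \<subseteq> K \<and> K - S \<noteq> {}" by auto
    then obtain x U where x: "x \<in> K - S" "openin X U" "U \<inter> (K - S) = {x}"
      using assms(3)[unfolded scattered_in_def, rule_format, of "K - S"] by metis
    then obtain V N where VN: "openin X V" "closedin X N" "x \<in> V" "V \<subseteq> N" "N \<subseteq> U"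
      using assms(1)[folded neighbourhood_base_of_closedin, unfolded neighbourhood_base_of, rule_format, of U x]
      by blast
    have "N \<inter> K \<subseteq> S \<union> {x}" using x VN by blast
    define R where "R n = {y \<in> topspace X. dist (h y) (h x) \<ge> inverse (real (Suc n))}" for n
    have "closedin X (R n)" for n
    proof -
      have "closedin X {y \<in> topspace X. h y \<in> {z. dist z (h x) \<ge> inverse (real (Suc n))}}"
        using assms(4)
        by (rule closedin_continuous_map_preimage) (auto intro!: closed_Collect_le continuous_intros)
      then show ?thesis by (simp add: R_def)
    qed
    then have "compactin X (N \<inter> R n \<inter> K)" for n
      using VN(2) assms(2) by (intro closed_Int_compactin closedin_Int) auto
    moreover have "x \<notin> R n" for n by (simp add: R_def)
    ultimately have "countable (h ` (N \<inter> R n \<inter> K))" for n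
      using \<open>N \<inter> K \<subseteq> S \<union> {x}\<close> by (intro compact_in_S) auto
    then have "countable (insert (h x) (\<Union>n. h ` (N \<inter> R n \<inter> K)))" by auto
    moreover have "h ` (V \<inter> K) \<subseteq> insert (h x) (\<Union>n. h ` (N \<inter> R n \<inter> K))"
    proof clarsimp
      fix y assume y: "y \<in> V" "y \<in> K" "\<forall>n. h y \<notin> h ` (N \<inter> R n \<inter> K)"
      show "h y = h x"
      proof (rule ccontr)
        assume "h y \<noteq> h x"
        then obtain n where "inverse (real (Suc n)) < dist (h y) (h x)"
          using reals_Archimedean[of "dist (h y) (h x)"] by auto
        then have "y \<in> R n" using y(1) VN(1) openin_subset by (fastforce simp: R_def)
        then show False using y VN(4) by blast
      qed
    qed
    ultimately have "countable (h ` (V \<inter> K))" by (rule countable_subset[rotated])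
    then have "x \<in> S" unfolding S_def using VN by blast
    then show False using x by blast
  qed
  then show ?thesis using compact_in_S assms(2) by blast
qed

text \<open>The independence argument asks for a countable supply of functions. A second countable
  space has a countable basis, so finite unions of basic sets are countably many, and a steep
  truncated distance to the complement of such a union separates \<open>P\<close> from
  \<open>A\<close>.\<close>

lemma countable_separating_bcontfuns:
  fixes \<epsilon> :: real
  assumes "\<epsilon> > 0"
  obtains \<F> :: "('a::{metric_space,second_countable_topology} \<Rightarrow>\<^sub>C real) set" where "countable \<F>"
    "\<And>g z. g \<in> \<F> \<Longrightarrow> 0 \<le> apply_bcontfun g z \<and> apply_bcontfun g z \<le> \<epsilon>"
    "\<And>A P. finite A \<Longrightarrow> finite P \<Longrightarrow> A \<inter> P = {} \<Longrightarrow>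
      \<exists>g\<in>\<F>. (\<forall>a\<in>A. apply_bcontfun g a = 0) \<and> (\<forall>p\<in>P. apply_bcontfun g p = \<epsilon>)"
proof -
  \<comment> \<open>The distance to the empty set is 0 by convention, so \<open>U = UNIV\<close> is
    a separate case.\<close>
  define b where "b U q z = (if U = UNIV then \<epsilon> else \<epsilon> * min 1 (real q * infdist z (- U)))" for U :: "'a set" and q z
  have cont: "continuous_on UNIV (b U q)" for U q
    unfolding b_def by (cases "U = UNIV") (auto intro!: continuous_intros)
  have rng: "0 \<le> b U q z" "b U q z \<le> \<epsilon>" for U q z
    using assms unfolding b_def by (auto simp: infdist_nonneg mult_left_le)
  have "b U q \<in> bcontfun" for U q
    unfolding bcontfun_def using cont rng by (auto intro!: boundedI[where B=\<epsilon>])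
  then have ap: "apply_bcontfun (Bcontfun (b U q)) = b U q" for U q by (rule Bcontfun_inverse)
  obtain B :: "'a set set" where B: "countable B" "topological_basis B" using ex_countable_basis by auto
  define \<N> where "\<N> = {\<G>. finite \<G> \<and> \<G> \<subseteq> B}"
  have "countable \<N>" unfolding \<N>_def by (rule countable_Collect_finite_subset[OF B(1)])
  define \<F> where "\<F> = (\<lambda>(\<G>,q). Bcontfun (b (\<Union>\<G>) q)) ` (\<N> \<times> UNIV)"
  show thesis
  proof
    show "countable \<F>" unfolding \<F>_def using \<open>countable \<N>\<close> by auto
    show "0 \<le> apply_bcontfun g z \<and> apply_bcontfun g z \<le> \<epsilon>" if "g \<in> \<F>" for g z
      using that rng unfolding \<F>_def by (auto simp: ap)
    fix A P :: "'a set" assume AP: "finite A" "finite P" "A \<inter> P = {}"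
    have "open (- A)" using AP(1) by (simp add: finite_imp_closed open_Compl)
    then have "\<exists>U\<in>B. p \<in> U \<and> U \<subseteq> - A" if "p \<in> P" for p
      using B(2) that AP(3) by (metis ComplI disjoint_iff topological_basisE)
    then obtain u where u: "\<And>p. p \<in> P \<Longrightarrow> u p \<in> B \<and> p \<in> u p \<and> u p \<subseteq> - A" by metis
    define U where "U = \<Union>(u ` P)"
    have UN: "u ` P \<in> \<N>" using u AP(2) unfolding \<N>_def by auto
    have PU: "P \<subseteq> U" "U \<subseteq> - A" using u unfolding U_def by auto
    have oU: "open U" unfolding U_def using u B(2) by (auto intro!: open_Union topological_basis_open)
    have "\<exists>q. U = UNIV \<or> 1 \<le> real q * infdist p (- U)" if "p \<in> P" for p
    proof (cases "U = UNIV")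
      case False
      then have "infdist p (- U) > 0"
        using oU PU(1) that by (intro infdist_pos_not_in_closed) auto
      then obtain q :: nat where "1 < real q * infdist p (- U)"
        using reals_Archimedean3 by blast
      then show ?thesis by (meson less_imp_le)
    qed auto
    then obtain q where q: "\<And>p. p \<in> P \<Longrightarrow> U = UNIV \<or> 1 \<le> real (q p) * infdist p (- U)" by metis
    \<comment> \<open>A slope that serves all points of \<open>P\<close> at once; the inserted 0
      covers empty \<open>P\<close>.\<close>
    define Q where "Q = Max (insert 0 (q ` P))"
    have "q p \<le> Q" if "p \<in> P" for p unfolding Q_def using AP(2) that by auto
    then have Q: "U = UNIV \<or> 1 \<le> real Q * infdist p (- U)" if "p \<in> P" for p
      using q[OF that] that by (meson infdist_nonneg mult_right_mono of_nat_mono order_trans)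
    have "b U Q p = \<epsilon>" if "p \<in> P" for p using Q[OF that] unfolding b_def by (auto simp: min_def)
    moreover have "b U Q a = 0" if "a \<in> A" for a
    proof -
      have "a \<in> - U" using that PU(2) by auto
      then show ?thesis unfolding b_def by auto
    qed
    moreover have "Bcontfun (b U Q) \<in> \<F>"
      unfolding \<F>_def U_def using UN by (intro image_eqI[where x="(u ` P, Q)"]) auto
    ultimately show "\<exists>g\<in>\<F>. (\<forall>a\<in>A. apply_bcontfun g a = 0) \<and> (\<forall>p\<in>P. apply_bcontfun g p = \<epsilon>)"
      by (intro bexI[of _ "Bcontfun (b U Q)"]) (auto simp: ap)
  qed
qed

lemma continuous_on_bcontfun_eval: "continuous_on UNIV (\<lambda>g. apply_bcontfun g z)"
  by (rule continuous_on_iff[THEN iffD2]) (metis dist_bounded le_less_trans)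

section \<open>Neighbourhoods in the weak topology\<close>

lemma topspace_weak_topology [simp]: "topspace (weak_topology :: 'e::real_normed_vector topology) = UNIV"
proof -
  have "UNIV = (\<lambda>_::'e. 0::real) -` UNIV" by auto
  then have "openin weak_topology (UNIV :: 'e set)"
    unfolding weak_topology_def using bounded_linear_zero
    by (intro topology_generated_by_Basis) blast
  then show ?thesis using openin_subset by blast
qed

lemma continuous_map_weak_functional:
  "continuous_map weak_topology euclideanreal (blinfun_apply (\<phi> :: 'e::real_normed_vector \<Rightarrow>\<^sub>L real))"
  unfolding continuous_map_def topspace_weak_topology
proof (intro conjI allI impI)
  fix U :: "real set" assume "openin euclidean U"
  then have "open U" by simp
  then have "openin weak_topology (blinfun_apply \<phi> -` U)"
    unfolding weak_topology_def using blinfun.bounded_linear_right[of \<phi>]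
    by (intro topology_generated_by_Basis CollectI exI[of _ "blinfun_apply \<phi>"] exI[of _ U]) auto
  then show "openin weak_topology {x \<in> UNIV. blinfun_apply \<phi> x \<in> U}" by (simp add: vimage_def)
qed auto

text \<open>Induction over the generation of the weak topology. A two-sided condition is imposed
  through a functional and its negative, and the radius is absorbed by scaling to 1.\<close>

lemma weak_nhd_functionals:
  fixes W :: "'e::real_normed_vector set"
  assumes "openin weak_topology W" "e0 \<in> W"
  obtains F :: "('e \<Rightarrow>\<^sub>L real) set" where "finite F"
    "\<forall>e. (\<forall>\<phi>\<in>F. blinfun_apply \<phi> (e - e0) < 1) \<longrightarrow> e \<in> W"
proof -
  have "generate_topology_on {f -` U | (f :: 'e \<Rightarrow> real) U. bounded_linear f \<and> open U} W"
    using assms(1) unfolding weak_topology_def openin_topology_generated_by_iff .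
  then have "e0 \<in> W \<longrightarrow> (\<exists>F :: ('e \<Rightarrow>\<^sub>L real) set. finite F \<and> (\<forall>e. (\<forall>\<phi>\<in>F. blinfun_apply \<phi> (e - e0) < 1) \<longrightarrow> e \<in> W))"
  proof (induction rule: generate_topology_on.induct)
    case Empty
    then show ?case by simp
  next
    case (Int a b)
    show ?case
    proof
      assume "e0 \<in> a \<inter> b"
      then obtain F G :: "('e \<Rightarrow>\<^sub>L real) set" where
        "finite F" "\<forall>e. (\<forall>\<phi>\<in>F. blinfun_apply \<phi> (e - e0) < 1) \<longrightarrow> e \<in> a"
        "finite G" "\<forall>e. (\<forall>\<phi>\<in>G. blinfun_apply \<phi> (e - e0) < 1) \<longrightarrow> e \<in> b"
        using Int by blast
      then show "\<exists>F :: ('e \<Rightarrow>\<^sub>L real) set. finite F \<and> (\<forall>e. (\<forall>\<phi>\<in>F. blinfun_apply \<phi> (e - e0) < 1) \<longrightarrow> e \<in> a \<inter> b)"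
        by (intro exI[of _ "F \<union> G"]) auto
    qed
  next
    case (UN \<K>)
    then show ?case by (meson UnionE UnionI)
  next
    case (Basis s)
    then obtain f :: "'e \<Rightarrow> real" and U where s: "s = f -` U" and f: "bounded_linear f" and U: "open U"
      by blast
    show ?case
    proof
      assume "e0 \<in> s"
      then obtain \<delta> where \<delta>: "\<delta> > 0" "\<And>t. \<bar>t - f e0\<bar> < \<delta> \<Longrightarrow> t \<in> U"
        using U unfolding open_dist s dist_real_def by auto
      define \<phi> where "\<phi> = (1/\<delta>) *\<^sub>R Blinfun f"
      have \<phi>: "blinfun_apply \<phi> (e - e0) = (f e - f e0) / \<delta>" for e
        using f by (simp add: \<phi>_def scaleR_blinfun.rep_eq bounded_linear_Blinfun_apply linear_diff bounded_linear.linear)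
      have "e \<in> s" if "\<forall>\<psi>\<in>{\<phi>, -\<phi>}. blinfun_apply \<psi> (e - e0) < 1" for e
      proof -
        have "(f e - f e0) / \<delta> < 1" "- ((f e - f e0) / \<delta>) < 1"
          using that by (auto simp: \<phi> uminus_blinfun.rep_eq)
        then have "\<bar>f e - f e0\<bar> < \<delta>" using \<delta>(1) by (auto simp: field_simps abs_less_iff)
        then show ?thesis using \<delta>(2) s by auto
      qed
      then show "\<exists>F :: ('e \<Rightarrow>\<^sub>L real) set. finite F \<and> (\<forall>e. (\<forall>\<phi>\<in>F. blinfun_apply \<phi> (e - e0) < 1) \<longrightarrow> e \<in> s)"
        by (intro exI[of _ "{\<phi>, -\<phi>}"]) auto
    qed
  qed
  then show thesis using that assms(2) by blast
qed

section \<open>Neighbourhoods in \<open>Cp X\<close>\<close>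

lemma topspace_Cp: "topspace (Cp X) = {f. continuous_map X euclideanreal f \<and> f \<in> extensional (topspace X)}"
  unfolding Cp_def by (auto simp: PiE_def)

lemma restrict_in_Cp: "continuous_map X euclideanreal f \<Longrightarrow> restrict f (topspace X) \<in> topspace (Cp X)"
  unfolding topspace_Cp by (auto intro: continuous_map_eq)

lemma Cp_nhd_finite:
  assumes "openin (Cp X) W" "f0 \<in> W"
  obtains A \<delta> where "finite A" "A \<subseteq> topspace X" "\<delta> > (0::real)"
    "\<forall>f\<in>topspace (Cp X). (\<forall>a\<in>A. \<bar>f a - f0 a\<bar> < \<delta>) \<longrightarrow> f \<in> W"
proof -
  let ?P = "product_topology (\<lambda>_. euclideanreal) (topspace X)"
  obtain S where S: "openin ?P S" "W = S \<inter> {f. continuous_map X euclideanreal f \<and> f \<in> extensional (topspace X)}"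
    using assms(1) unfolding Cp_def openin_subtopology by blast
  then have "f0 \<in> S" using assms(2) by blast
  then obtain U where U: "finite {x \<in> topspace X. U x \<noteq> UNIV}" "\<And>x. x \<in> topspace X \<Longrightarrow> open (U x)"
    "f0 \<in> Pi\<^sub>E (topspace X) U" "Pi\<^sub>E (topspace X) U \<subseteq> S"
    using S(1) unfolding openin_product_topology_alt by auto
  define A where "A = {x \<in> topspace X. U x \<noteq> UNIV}"
  have "\<exists>\<delta>>0. \<forall>t. \<bar>t - f0 a\<bar> < \<delta> \<longrightarrow> t \<in> U a" if "a \<in> A" for a
  proof -
    have "open (U a)" "f0 a \<in> U a" using that U(2,3) unfolding A_def by auto
    then show ?thesis unfolding open_dist dist_real_def by auto
  qed
  then obtain d where d: "\<And>a. a \<in> A \<Longrightarrow> d a > 0" "\<And>a t. a \<in> A \<Longrightarrow> \<bar>t - f0 a\<bar> < d a \<Longrightarrow> t \<in> U a" by metis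
  define \<delta> where "\<delta> = Min (insert 1 (d ` A))"
  have fin: "finite A" using U(1) unfolding A_def .
  have "\<delta> > 0" "\<And>a. a \<in> A \<Longrightarrow> \<delta> \<le> d a" using d(1) fin unfolding \<delta>_def by auto
  then show thesis
  proof (intro that[OF fin] ballI impI)
    fix f assume f: "f \<in> topspace (Cp X)" "\<forall>a\<in>A. \<bar>f a - f0 a\<bar> < \<delta>"
    have "f x \<in> U x" if "x \<in> topspace X" for x
    proof (cases "x \<in> A")
      case True
      then show ?thesis using d(2) f(2) \<open>\<And>a. a \<in> A \<Longrightarrow> \<delta> \<le> d a\<close> by (meson less_le_trans)
    next
      case False
      then show ?thesis using that unfolding A_def by auto
    qed
    then have "f \<in> Pi\<^sub>E (topspace X) U" using f(1) unfolding topspace_Cp by (auto simp: PiE_iff)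
    then show "f \<in> W" using f(1) U(4) S(2) unfolding topspace_Cp by blast
  qed (auto simp: A_def)
qed

lemma continuous_map_Cp_eval: "x \<in> topspace X \<Longrightarrow> continuous_map (Cp X) euclideanreal (\<lambda>f. f x)"
  unfolding Cp_def by (intro continuous_map_from_subtopology continuous_map_product_projection)

subsection \<open>Homeomorphisms between function spaces and weak topologies\<close>

text \<open>\<open>T\<close> is a homeomorphism without linearity. Estimates are therefore made
  relative to a base point \<open>f0\<close> and concern differences
  \<open>T f - T f0\<close>.\<close>

locale Cp_weak_homeomorphism =
  fixes X :: "'x topology" and T :: "('x \<Rightarrow> real) \<Rightarrow> 'e::banach"
  assumes creg: "completely_regular_space X"
    and haus: "Hausdorff_space X"
    and infX: "infinite (topspace X)"
    and homeo: "homeomorphic_map (Cp X) weak_topology T"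
begin

lemma ex_preimage: obtains f where "f \<in> topspace (Cp X)" "T f = e"
  using homeomorphic_imp_surjective_map[OF homeo] by (metis UNIV_I imageE topspace_weak_topology)

lemma functional_continuous:
  "continuous_map (Cp X) euclideanreal (\<lambda>f. blinfun_apply \<phi> (T f))"
  using continuous_map_compose[OF homeomorphic_imp_continuous_map[OF homeo] continuous_map_weak_functional]
  by (simp add: o_def)

text \<open>Continuity of \<open>T\<close> at \<open>f0\<close>, carrying control from points of
  \<open>X\<close> to functionals on the Banach space; \<open>evaluation_small\<close> goes the
  opposite way.\<close>

lemma functionals_small:
  fixes F :: "('e \<Rightarrow>\<^sub>L real) set"
  assumes "f0 \<in> topspace (Cp X)" "finite F" "r > 0"
  obtains A \<delta> where "finite A" "A \<subseteq> topspace X" "\<delta> > (0::real)"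
    "\<forall>f\<in>topspace (Cp X). (\<forall>a\<in>A. \<bar>f a - f0 a\<bar> < \<delta>) \<longrightarrow> (\<forall>\<phi>\<in>F. blinfun_apply \<phi> (T f - T f0) < r)"
proof -
  define W where "W = topspace (Cp X) \<inter> (\<Inter>\<phi>\<in>F. {f \<in> topspace (Cp X). blinfun_apply \<phi> (T f) \<in> {..<r + blinfun_apply \<phi> (T f0)}})"
  have "openin (Cp X) {f \<in> topspace (Cp X). blinfun_apply \<phi> (T f) \<in> {..<r + blinfun_apply \<phi> (T f0)}}" for \<phi>
    by (rule openin_continuous_map_preimage[OF functional_continuous]) auto
  then have "openin (Cp X) W"
    unfolding W_def using assms(2) by (cases "F = {}") (auto intro!: openin_Int openin_Inter)
  moreover have "f0 \<in> W" using assms unfolding W_def by auto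
  ultimately obtain A \<delta> where A: "finite A" "A \<subseteq> topspace X" "\<delta> > (0::real)"
    "\<forall>f\<in>topspace (Cp X). (\<forall>a\<in>A. \<bar>f a - f0 a\<bar> < \<delta>) \<longrightarrow> f \<in> W"
    by (rule Cp_nhd_finite)
  show thesis
  proof (rule that[OF A(1,2,3)], intro ballI impI)
    fix f \<phi> assume "f \<in> topspace (Cp X)" "\<forall>a\<in>A. \<bar>f a - f0 a\<bar> < \<delta>" "\<phi> \<in> F"
    then have "f \<in> W" "\<phi> \<in> F" using A(4) by auto
    then show "blinfun_apply \<phi> (T f - T f0) < r" unfolding W_def by (auto simp: blinfun.diff_right)
  qed
qed

text \<open>Continuity of the inverse of \<open>T\<close>, from functionals back to points. Bounding
  number and norms by one \<open>m\<close> sorts the points of \<open>X\<close> into countably many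
  classes.\<close>

lemma evaluation_small:
  assumes "f0 \<in> topspace (Cp X)" "x \<in> topspace X" "r > (0::real)"
  obtains m :: nat and \<phi> :: "nat \<Rightarrow> 'e \<Rightarrow>\<^sub>L real" where "\<forall>i. norm (\<phi> i) \<le> m"
    "\<forall>f\<in>topspace (Cp X). (\<forall>i<m. blinfun_apply (\<phi> i) (T f - T f0) < 1) \<longrightarrow> \<bar>f x - f0 x\<bar> < r"
proof -
  define V where "V = {f \<in> topspace (Cp X). f x \<in> {f0 x - r <..< f0 x + r}}"
  have "openin (Cp X) V"
    unfolding V_def by (rule openin_continuous_map_preimage[OF continuous_map_Cp_eval[OF assms(2)]]) auto
  then have "openin weak_topology (T ` V)"
    using homeomorphic_imp_open_map[OF homeo] unfolding open_map_def by blast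
  moreover have "T f0 \<in> T ` V" using assms unfolding V_def by auto
  ultimately obtain F :: "('e \<Rightarrow>\<^sub>L real) set" where F: "finite F"
    "\<forall>e. (\<forall>\<phi>\<in>F. blinfun_apply \<phi> (e - T f0) < 1) \<longrightarrow> e \<in> T ` V"
    by (rule weak_nhd_functionals)
  obtain m :: nat and \<phi> :: "nat \<Rightarrow> 'e \<Rightarrow>\<^sub>L real" where \<phi>: "\<forall>i. norm (\<phi> i) \<le> m"
    "\<forall>e. (\<forall>i<m. blinfun_apply (\<phi> i) e < 1) \<longrightarrow> (\<forall>\<psi>\<in>F. blinfun_apply \<psi> e < 1)"
    by (rule finite_functionals_as_tuple[OF F(1)])
  show thesis
  proof (rule that[OF \<phi>(1)], intro ballI impI)
    fix f assume f: "f \<in> topspace (Cp X)" "\<forall>i<m. blinfun_apply (\<phi> i) (T f - T f0) < 1"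
    then have "T f \<in> T ` V" using \<phi>(2) F(2) by blast
    then have "f \<in> V"
      using homeomorphic_imp_injective_map[OF homeo] f(1) unfolding V_def by (auto dest: inj_onD)
    then show "\<bar>f x - f0 x\<bar> < r" unfolding V_def by auto
  qed
qed

lemma zero_in_Cp: "(\<lambda>x\<in>topspace X. 0) \<in> topspace (Cp X)"
  by (rule restrict_in_Cp) auto

lemma Cp_separating:
  assumes "finite A" "A \<subseteq> topspace X" "openin X V" "A \<subseteq> V"
  obtains f where "f \<in> topspace (Cp X)" "\<And>a. a \<in> A \<Longrightarrow> f a = 0" "\<And>x. x \<in> topspace X - V \<Longrightarrow> f x = c"
proof -
  have "compactin X A" using assms(1,2) by (rule finite_imp_compactin[rotated])
  moreover have "closedin X (topspace X - V)" using assms(3) by auto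
  moreover have "disjnt A (topspace X - V)" using assms(4) by (auto simp: disjnt_def)
  ultimately obtain f where f: "continuous_map X euclideanreal f" "f ` (topspace X - V) \<subseteq> {c}" "f ` A \<subseteq> {0}"
    using Urysohn_completely_regular_compact_closed_alt[OF creg] by metis
  show thesis
    by (rule that[OF restrict_in_Cp[OF f(1)]]) (use f assms in auto)
qed

text \<open>A bounded weak neighbourhood would make bounded sequences subconverge in norm, but an evaluation at a
  point outside a finite set is unbounded on the preimage of any weak neighbourhood.\<close>

lemma weak_neighbourhood_unbounded:
  fixes F :: "('e \<Rightarrow>\<^sub>L real) set"
  assumes "finite F"
  shows "\<exists>z. (\<forall>\<phi>\<in>F. \<bar>blinfun_apply \<phi> z\<bar> < 1) \<and> R < norm z"
proof (rule ccontr)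
  assume "\<not> ?thesis"
  then have bd: "norm z \<le> R" if "\<And>\<phi>. \<phi> \<in> F \<Longrightarrow> \<bar>blinfun_apply \<phi> z\<bar> < 1" for z
    using that by force
  have "R \<ge> 0" using bd[of 0] by simp
  \<comment> \<open>By homogeneity a bounded neighbourhood makes the norm controlled by the finitely
    many functionals in \<open>F\<close>.\<close>
  have bdt: "norm z \<le> R * t" if "t > 0" "\<And>\<phi>. \<phi> \<in> F \<Longrightarrow> \<bar>blinfun_apply \<phi> z\<bar> < t" for z t
  proof -
    have "norm ((1/t) *\<^sub>R z) \<le> R"
      using that by (intro bd) (auto simp: blinfun.scaleR_right abs_mult field_simps)
    then show ?thesis using that(1) by (simp add: field_simps)
  qed
  let ?f0 = "\<lambda>x\<in>topspace X. 0"
  obtain A \<delta> where A: "finite A" "A \<subseteq> topspace X" "\<delta> > (0::real)"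
    "\<forall>f\<in>topspace (Cp X). (\<forall>a\<in>A. \<bar>f a - ?f0 a\<bar> < \<delta>) \<longrightarrow>
      (\<forall>\<phi>\<in>F \<union> uminus ` F. blinfun_apply \<phi> (T f - T ?f0) < 1)"
    by (rule functionals_small[OF zero_in_Cp, of "F \<union> uminus ` F" 1]) (use assms in auto)
  obtain x where x: "x \<in> topspace X" "x \<notin> A" using infX A(1) by (meson finite_subset subsetI)
  have opx: "openin X (topspace X - {x})"
    using haus x(1) by (simp add: closedin_Hausdorff_sing_eq openin_diff)
  \<comment> \<open>Functions vanishing on \<open>A\<close> are constrained by \<open>F\<close> in
    the same way however large they are at \<open>x\<close>.\<close>
  have "\<exists>f. f \<in> topspace (Cp X) \<and> (\<forall>a\<in>A. f a = 0) \<and> f x = real k" for k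
  proof -
    obtain f where "f \<in> topspace (Cp X)" "\<And>a. a \<in> A \<Longrightarrow> f a = 0"
      "\<And>y. y \<in> topspace X - (topspace X - {x}) \<Longrightarrow> f y = real k"
      using Cp_separating[OF A(1,2) opx] A(2) x by blast
    then show ?thesis using x by blast
  qed
  then obtain f where f: "\<And>k. f k \<in> topspace (Cp X)" "\<And>k a. a \<in> A \<Longrightarrow> f k a = 0" "\<And>k. f k x = real k"
    by metis
  define z where "z k = T (f k) - T ?f0" for k
  have zb: "\<bar>blinfun_apply \<phi> (z k)\<bar> < 1" if "\<phi> \<in> F" for \<phi> k
  proof -
    have "\<forall>a\<in>A. \<bar>f k a - ?f0 a\<bar> < \<delta>" using A f(2) by auto
    then have "\<forall>\<phi>\<in>F \<union> uminus ` F. blinfun_apply \<phi> (z k) < 1" using A(4) f(1) unfolding z_def by blast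
    then have "blinfun_apply \<phi> (z k) < 1" "blinfun_apply (- \<phi>) (z k) < 1" using that by auto
    then show ?thesis by (auto simp: uminus_blinfun.rep_eq)
  qed
  have "Bseq (\<lambda>k. blinfun_apply \<phi> (z k))" if "\<phi> \<in> F" for \<phi>
    using zb[OF that] by (intro BseqI'[where K=1]) (auto intro: less_imp_le)
  then obtain r where r: "strict_mono (r :: nat \<Rightarrow> nat)" "\<And>\<phi>. \<phi> \<in> F \<Longrightarrow> convergent (\<lambda>k. blinfun_apply \<phi> (z (r k)))"
    using common_convergent_subsequence[OF assms, of "\<lambda>\<phi> k. blinfun_apply \<phi> (z k)"] by metis
  have "Cauchy (\<lambda>k. z (r k))"
  proof (rule metric_CauchyI)
    fix \<epsilon> :: real assume "\<epsilon> > 0"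
    define t where "t = \<epsilon> / (R + 1)"
    have t: "t > 0" "R * t < \<epsilon>" using \<open>\<epsilon> > 0\<close> \<open>R \<ge> 0\<close> unfolding t_def by (auto simp: field_simps)
    have "\<exists>N. \<forall>i\<ge>N. \<forall>j\<ge>N. \<bar>blinfun_apply \<phi> (z (r i)) - blinfun_apply \<phi> (z (r j))\<bar> < t" if "\<phi> \<in> F" for \<phi>
      using convergent_Cauchy[OF r(2)[OF that]] t(1) unfolding Cauchy_def dist_real_def by blast
    then obtain N where N: "\<And>\<phi> i j. \<phi> \<in> F \<Longrightarrow> i \<ge> N \<phi> \<Longrightarrow> j \<ge> N \<phi> \<Longrightarrow>
        \<bar>blinfun_apply \<phi> (z (r i)) - blinfun_apply \<phi> (z (r j))\<bar> < t" by metis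
    define N0 where "N0 = Max (insert 0 (N ` F))"
    have N0: "N \<phi> \<le> N0" if "\<phi> \<in> F" for \<phi> unfolding N0_def using assms that by auto
    show "\<exists>M. \<forall>m\<ge>M. \<forall>n\<ge>M. dist (z (r m)) (z (r n)) < \<epsilon>"
    proof (intro exI allI impI)
      fix i j assume ij: "i \<ge> N0" "j \<ge> N0"
      have "norm (z (r i) - z (r j)) \<le> R * t"
      proof (rule bdt[OF t(1)])
        fix \<phi> assume "\<phi> \<in> F"
        then show "\<bar>blinfun_apply \<phi> (z (r i) - z (r j))\<bar> < t"
          using N[of \<phi> i j] N0[of \<phi>] ij by (simp add: blinfun.diff_right)
      qed
      then show "dist (z (r i)) (z (r j)) < \<epsilon>" using t(2) unfolding dist_norm by linarith
    qed
  qed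
  then obtain l where l: "(\<lambda>k. z (r k)) \<longlonglongrightarrow> l" using Cauchy_convergent convergent_def by blast
  \<comment> \<open>Surjectivity turns the norm limit into a function \<open>g\<close>; continuity
    of the inverse keeps the values \<open>f (r k) x\<close> near \<open>g x\<close>, although they
    equal \<open>r k\<close>.\<close>
  obtain g where g: "g \<in> topspace (Cp X)" "T g = T ?f0 + l" by (rule ex_preimage)
  obtain m :: nat and \<phi> :: "nat \<Rightarrow> 'e \<Rightarrow>\<^sub>L real" where \<phi>: "\<forall>h\<in>topspace (Cp X).
      (\<forall>i<m. blinfun_apply (\<phi> i) (T h - T g) < 1) \<longrightarrow> \<bar>h x - g x\<bar> < 1"
    by (rule evaluation_small[OF g(1) x(1), of 1]) auto
  have "\<forall>\<^sub>F k in sequentially. \<forall>i\<in>{..<m}. blinfun_apply (\<phi> i) (T (f (r k)) - T g) < 1"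
  proof (rule eventually_ball_finite, simp, intro ballI)
    fix i
    have "(\<lambda>k. blinfun_apply (\<phi> i) (z (r k) - l)) \<longlonglongrightarrow> blinfun_apply (\<phi> i) (l - l)"
      using l by (intro tendsto_intros)
    then have "\<forall>\<^sub>F k in sequentially. blinfun_apply (\<phi> i) (z (r k) - l) < 1"
      by (auto intro: order_tendstoD(2))
    then show "\<forall>\<^sub>F k in sequentially. blinfun_apply (\<phi> i) (T (f (r k)) - T g) < 1"
      unfolding z_def g(2) by (simp add: diff_diff_eq)
  qed
  then have "\<forall>\<^sub>F k in sequentially. \<bar>real (r k) - g x\<bar> < 1"
  proof eventually_elim
    case (elim k)
    then show ?case using \<phi> f(1)[of "r k"] f(3)[of "r k"] by auto
  qed
  moreover have "\<forall>\<^sub>F k in sequentially. real k > g x + 1"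
    using filterlim_real_sequentially unfolding filterlim_at_top_dense by blast
  ultimately have "\<forall>\<^sub>F k :: nat in sequentially. False"
  proof eventually_elim
    case (elim k)
    then show ?case using seq_suble[OF r(1), of k] by linarith
  qed
  then show False by simp
qed

section \<open>Compact pieces of \<open>X\<close>\<close>

text \<open>Given an open cover of the closure of \<open>Z m\<close>, consider functions that are at
  most 1 in modulus on this closure only where finitely many cover members suffice. Weak*
  compactness of bounded \<open>m\<close>-tuples selects finitely many such functions, and each
  point of \<open>Z m\<close> lies in the small part of one of them.\<close>

lemma sigma_compact: "\<exists>K :: nat \<Rightarrow> 'x set. topspace X = (\<Union>n. K n) \<and> (\<forall>n. compactin X (K n))"
proof -
  define f0 where "f0 = (\<lambda>x\<in>topspace X. 0::real)"
  have f0: "f0 \<in> topspace (Cp X)" unfolding f0_def by (rule zero_in_Cp)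
  define Z where "Z m = {x \<in> topspace X. \<exists>\<phi> :: nat \<Rightarrow> 'e \<Rightarrow>\<^sub>L real. (\<forall>i. norm (\<phi> i) \<le> real m) \<and>
    (\<forall>f\<in>topspace (Cp X). (\<forall>i<m. blinfun_apply (\<phi> i) (T f - T f0) < 1) \<longrightarrow> \<bar>f x - f0 x\<bar> < 1)}" for m
  have ZX: "Z m \<subseteq> topspace X" for m unfolding Z_def by auto
  have exZ: "\<exists>m. x \<in> Z m" if x: "x \<in> topspace X" for x
  proof -
    obtain m :: nat and \<phi> :: "nat \<Rightarrow> 'e \<Rightarrow>\<^sub>L real" where "\<forall>i. norm (\<phi> i) \<le> m"
      "\<forall>f\<in>topspace (Cp X). (\<forall>i<m. blinfun_apply (\<phi> i) (T f - T f0) < 1) \<longrightarrow> \<bar>f x - f0 x\<bar> < 1"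
      by (rule evaluation_small[OF f0 x zero_less_one])
    then show ?thesis using x unfolding Z_def by blast
  qed
  have "topspace X = (\<Union>m. X closure_of Z m)"
  proof (intro subset_antisym UN_least closure_of_subset_topspace)
    have "topspace X \<subseteq> (\<Union>m. Z m)" using exZ by blast
    also have "\<dots> \<subseteq> (\<Union>m. X closure_of Z m)" by (intro UN_mono closure_of_subset ZX order_refl)
    finally show "topspace X \<subseteq> (\<Union>m. X closure_of Z m)" .
  qed
  moreover have "compactin X (X closure_of Z m)" for m
    unfolding compactin_def
  proof (intro conjI allI impI closure_of_subset_topspace, elim conjE)
    fix \<U> assume \<U>: "Ball \<U> (openin X)" "X closure_of Z m \<subseteq> \<Union>\<U>"
    define C where "C = X closure_of Z m"
    define ok where "ok f \<V> \<longleftrightarrow> f \<in> topspace (Cp X) \<and> finite \<V> \<and> \<V> \<subseteq> \<U> \<and> (\<forall>x\<in>C. \<bar>f x\<bar> \<le> 1 \<longrightarrow> x \<in> \<Union>\<V>)" for f \<V>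
    define A where "A = {T f - T f0 |f \<V>. ok f \<V>}"
    have "\<exists>a\<in>A. \<forall>i<m. blinfun_apply (\<phi> i) a < 1" for \<phi> :: "nat \<Rightarrow> 'e \<Rightarrow>\<^sub>L real"
    proof -
      obtain D \<delta> where D: "finite D" "D \<subseteq> topspace X" "\<delta> > (0::real)"
        "\<forall>f\<in>topspace (Cp X). (\<forall>a\<in>D. \<bar>f a - f0 a\<bar> < \<delta>) \<longrightarrow> (\<forall>\<psi>\<in>\<phi> ` {..<m}. blinfun_apply \<psi> (T f - T f0) < 1)"
        by (rule functionals_small[OF f0 finite_imageI[OF finite_lessThan] zero_less_one])
      have "\<forall>a\<in>D \<inter> C. \<exists>U\<in>\<U>. a \<in> U" using \<U>(2) unfolding C_def by blast
      then obtain u where u: "\<And>a. a \<in> D \<inter> C \<Longrightarrow> u a \<in> \<U> \<and> a \<in> u a" by metis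
      \<comment> \<open>Adding the complement of \<open>C\<close> makes \<open>V\<close> a
        neighbourhood of all of \<open>D\<close> and changes nothing inside \<open>C\<close>.
        Vanishing on \<open>D\<close> meets the constraints of the tuple, and the value 2 off
        \<open>V\<close> exceeds the threshold 1.\<close>
      define V where "V = \<Union>(u ` (D \<inter> C)) \<union> (topspace X - C)"
      have "openin X V"
        unfolding V_def using u \<U>(1) by (intro openin_Un openin_Union) (auto simp: C_def)
      moreover have "D \<subseteq> V" using u D(2) unfolding V_def by blast
      ultimately obtain f where f: "f \<in> topspace (Cp X)" "\<And>a. a \<in> D \<Longrightarrow> f a = 0"
        "\<And>x. x \<in> topspace X - V \<Longrightarrow> f x = 2"
        using Cp_separating[OF D(1,2), of V] by metis
      have "x \<in> \<Union>(u ` (D \<inter> C))" if x: "x \<in> C" "\<bar>f x\<bar> \<le> 1" for x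
      proof -
        have "x \<in> topspace X" using x(1) unfolding C_def by (rule subsetD[OF closure_of_subset_topspace])
        then have "x \<in> V" using f(3)[of x] x(2) by (cases "x \<in> V") auto
        then show ?thesis using x(1) unfolding V_def by blast
      qed
      then have "ok f (u ` (D \<inter> C))" unfolding ok_def using f(1) D(1) u by auto
      then have "T f - T f0 \<in> A" unfolding A_def by blast
      moreover have "\<forall>a\<in>D. \<bar>f a - f0 a\<bar> < \<delta>" using f(2) D(2,3) unfolding f0_def by auto
      then have "\<forall>i<m. blinfun_apply (\<phi> i) (T f - T f0) < 1" using D(4) f(1) by blast
      ultimately show ?thesis by blast
    qed
    then have "\<exists>A0. finite A0 \<and> A0 \<subseteq> A \<and> (\<forall>\<phi> :: nat \<Rightarrow> 'e \<Rightarrow>\<^sub>L real. (\<forall>i. norm (\<phi> i) \<le> real m) \<longrightarrow>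
        (\<exists>a\<in>A0. \<forall>i<m. blinfun_apply (\<phi> i) a < 1))"
      by (intro finitely_many_vectors_for_bounded_tuples) auto
    then obtain A0 where A0: "finite A0" "A0 \<subseteq> A"
      "\<forall>\<phi> :: nat \<Rightarrow> 'e \<Rightarrow>\<^sub>L real. (\<forall>i. norm (\<phi> i) \<le> real m) \<longrightarrow> (\<exists>a\<in>A0. \<forall>i<m. blinfun_apply (\<phi> i) a < 1)"
      by (elim exE conjE)
    have "\<forall>a\<in>A0. \<exists>f \<V>. a = T f - T f0 \<and> ok f \<V>" using A0(2) unfolding A_def by blast
    then obtain f \<V> where f: "\<And>a. a \<in> A0 \<Longrightarrow> a = T (f a) - T f0 \<and> ok (f a) (\<V> a)" by metis
    \<comment> \<open>Non-strict bounds make \<open>L\<close> closed, so that it contains the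
      closure together with \<open>Z m\<close>.\<close>
    define L where "L = (\<Union>a\<in>A0. {x \<in> topspace X. f a x \<in> {-1..1}})"
    have "closedin X {x \<in> topspace X. f a x \<in> {-1..1}}" if "a \<in> A0" for a
      using f[OF that] unfolding ok_def topspace_Cp
      by (intro closedin_continuous_map_preimage[of X euclideanreal]) auto
    then have "closedin X L"
      unfolding L_def using A0(1) by (intro closedin_Union) auto
    moreover have "Z m \<subseteq> L"
    proof
      fix x assume "x \<in> Z m"
      then obtain \<phi> :: "nat \<Rightarrow> 'e \<Rightarrow>\<^sub>L real" where x: "x \<in> topspace X" and \<phi>: "\<forall>i. norm (\<phi> i) \<le> real m"
        "\<forall>f\<in>topspace (Cp X). (\<forall>i<m. blinfun_apply (\<phi> i) (T f - T f0) < 1) \<longrightarrow> \<bar>f x - f0 x\<bar> < 1"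
        unfolding Z_def by blast
      obtain a where a: "a \<in> A0" "\<forall>i<m. blinfun_apply (\<phi> i) a < 1" using A0(3) \<phi>(1) by blast
      then have "\<bar>f a x - f0 x\<bar> < 1" using f[OF a(1)] \<phi>(2) unfolding ok_def by metis
      then have "f a x \<in> {-1..1}" using x unfolding f0_def by (simp add: abs_less_iff)
      then show "x \<in> L" using a(1) x unfolding L_def by blast
    qed
    ultimately have "C \<subseteq> L" unfolding C_def by (rule closure_of_minimal[rotated])
    have "C \<subseteq> \<Union>(\<Union>a\<in>A0. \<V> a)"
    proof
      fix x assume "x \<in> C"
      then obtain a where a: "a \<in> A0" "\<bar>f a x\<bar> \<le> 1" using \<open>C \<subseteq> L\<close> unfolding L_def by (auto simp: abs_le_iff)
      then have "x \<in> \<Union>(\<V> a)" using f[OF a(1)] \<open>x \<in> C\<close> unfolding ok_def by blast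
      then show "x \<in> \<Union>(\<Union>a\<in>A0. \<V> a)" using a(1) by blast
    qed
    moreover have "finite (\<Union>a\<in>A0. \<V> a)" "(\<Union>a\<in>A0. \<V> a) \<subseteq> \<U>"
      using f A0(1) unfolding ok_def by auto
    ultimately show "\<exists>\<F>. finite \<F> \<and> \<F> \<subseteq> \<U> \<and> X closure_of Z m \<subseteq> \<Union>\<F>"
      unfolding C_def by blast
  qed
  ultimately show ?thesis by blast
qed

section \<open>Metrizable images of \<open>X\<close>\<close>

text \<open>The set consists of the vectors on which a fixed functional \<open>\<phi>\<close>
  exceeds the reciprocal of the norm. It clusters at 0 since weak neighbourhoods are unbounded; a
  weakly null sequence in it would be bounded, which keeps \<open>\<phi>\<close> away from 0 along
  it.\<close>

lemma weakly_clustering_set_without_null_sequence: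
  obtains A :: "'e set" where
    "\<And>F :: ('e \<Rightarrow>\<^sub>L real) set. finite F \<Longrightarrow> \<exists>a\<in>A. \<forall>\<phi>\<in>F. blinfun_apply \<phi> a < 1"
    "\<And>y. (\<And>k::nat. y k \<in> A) \<Longrightarrow> \<exists>\<phi> :: 'e \<Rightarrow>\<^sub>L real. \<not> (\<lambda>k. blinfun_apply \<phi> (y k)) \<longlonglongrightarrow> 0"
proof -
  obtain u :: 'e where u: "0 < norm u"
    using weak_neighbourhood_unbounded[of "{}" 0] by auto
  obtain \<phi> :: "'e \<Rightarrow>\<^sub>L real" where \<phi>: "blinfun_apply \<phi> u = norm u" by (rule Hahn_Banach_norming)
  define e where "e = (1 / norm u) *\<^sub>R u"
  have e: "blinfun_apply \<phi> e = 1" "norm e = 1" using u by (auto simp: e_def blinfun.scaleR_right \<phi>)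
  define A where "A = {y. blinfun_apply \<phi> y > 0 \<and> norm y * blinfun_apply \<phi> y > 1}"
  show thesis
  proof
    fix F :: "('e \<Rightarrow>\<^sub>L real) set" assume F: "finite F"
    define \<sigma> where "\<sigma> = (\<Sum>\<psi>\<in>F. \<bar>blinfun_apply \<psi> e\<bar>)"
    \<comment> \<open>\<open>t\<close> makes the multiple of \<open>e\<close> use at most half of
      each constraint in \<open>F\<close>. The perturbation \<open>z\<close> uses less than the
      other half, changes \<open>\<phi>\<close> by less than \<open>t / 2\<close> and is longer than
      \<open>2 / t + t\<close>, so norm times \<open>\<phi>\<close> exceeds
      \<open>(2 / t) * (t / 2) = 1\<close>.\<close>
    define t where "t = 1 / (2 * (1 + \<sigma>))"
    have s0: "\<sigma> \<ge> 0" unfolding \<sigma>_def by (simp add: sum_nonneg)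
    then have t: "t > 0" unfolding t_def by simp
    have te: "blinfun_apply \<psi> (t *\<^sub>R e) \<le> 1 / 2" if "\<psi> \<in> F" for \<psi>
    proof -
      have "blinfun_apply \<psi> e \<le> \<sigma>"
        unfolding \<sigma>_def using member_le_sum[OF that, of "\<lambda>\<psi>. \<bar>blinfun_apply \<psi> e\<bar>"] F by auto
      then show ?thesis using s0 unfolding t_def by (simp add: blinfun.scaleR_right field_simps)
    qed
    obtain z where z: "\<forall>\<psi>\<in>insert ((2 / t) *\<^sub>R \<phi>) ((\<lambda>\<psi>. 2 *\<^sub>R \<psi>) ` F). \<bar>blinfun_apply \<psi> z\<bar> < 1"
      "2 / t + t < norm z"
      using weak_neighbourhood_unbounded[of "insert ((2 / t) *\<^sub>R \<phi>) ((\<lambda>\<psi>. 2 *\<^sub>R \<psi>) ` F)" "2 / t + t"] F by auto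
    have "\<bar>(2 / t) * blinfun_apply \<phi> z\<bar> < 1" using z(1) by (simp add: scaleR_blinfun.rep_eq)
    then have "\<bar>blinfun_apply \<phi> z\<bar> < t / 2" using t by (simp add: abs_mult field_simps)
    then have py: "blinfun_apply \<phi> (t *\<^sub>R e + z) > t / 2"
      using e(1) by (simp add: blinfun.add_right blinfun.scaleR_right)
    have "norm (t *\<^sub>R e) = t" using e(2) t by simp
    then have ny: "norm (t *\<^sub>R e + z) > 2 / t" using z(2) norm_diff_ineq[of z "t *\<^sub>R e"] by (simp add: add.commute)
    have "(2 / t) * (t / 2) < norm (t *\<^sub>R e + z) * blinfun_apply \<phi> (t *\<^sub>R e + z)"
      using py ny t by (intro mult_strict_mono) auto
    then have "t *\<^sub>R e + z \<in> A" unfolding A_def using py t by auto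
    moreover have "blinfun_apply \<psi> (t *\<^sub>R e + z) < 1" if "\<psi> \<in> F" for \<psi>
    proof -
      have "\<bar>2 * blinfun_apply \<psi> z\<bar> < 1" using z(1) that by (simp add: scaleR_blinfun.rep_eq)
      then show ?thesis using te[OF that] by (simp add: blinfun.add_right)
    qed
    ultimately show "\<exists>a\<in>A. \<forall>\<phi>\<in>F. blinfun_apply \<phi> a < 1" by blast
  next
    fix y :: "nat \<Rightarrow> 'e" assume y: "\<And>k. y k \<in> A"
    show "\<exists>\<phi> :: 'e \<Rightarrow>\<^sub>L real. \<not> (\<lambda>k. blinfun_apply \<phi> (y k)) \<longlonglongrightarrow> 0"
    proof (rule ccontr)
      assume "\<not> ?thesis"
      then have lim: "(\<lambda>k. blinfun_apply \<psi> (y k)) \<longlonglongrightarrow> 0" for \<psi> :: "'e \<Rightarrow>\<^sub>L real" by blast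
      then have "Bseq (\<lambda>k. blinfun_apply \<psi> (y k))" for \<psi> :: "'e \<Rightarrow>\<^sub>L real"
        by (meson convergentI convergent_imp_Bseq)
      then have "Bseq y" by (rule weakly_bounded_imp_bounded)
      then obtain c where c: "c > 0" "\<And>k. norm (y k) \<le> c" unfolding Bseq_def by blast
      have "\<forall>\<^sub>F k in sequentially. blinfun_apply \<phi> (y k) < 1 / c"
        using lim[of \<phi>] c(1) by (intro order_tendstoD(2)) auto
      then obtain k where "blinfun_apply \<phi> (y k) < 1 / c" by (meson eventually_sequentially order_refl)
      then have "c * blinfun_apply \<phi> (y k) < 1" using c(1) by (simp add: field_simps)
      moreover have "norm (y k) * blinfun_apply \<phi> (y k) \<le> c * blinfun_apply \<phi> (y k)"
        using y[of k] c(2) unfolding A_def by (intro mult_right_mono) auto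
      ultimately show False using y[of k] unfolding A_def by auto
    qed
  qed
qed

text \<open>\<open>h\<close> records the preimages of a countable clustering set relative to that of
  0. Were its image countable, a diagonal choice would give preimages converging pointwise to that
  of 0, hence a weakly null sequence in \<open>A\<close>.\<close>

lemma uncountable_metrizable_image:
  obtains h :: "'x \<Rightarrow> nat \<Rightarrow> real" where "continuous_map X euclidean h" "uncountable (h ` topspace X)"
proof -
  obtain A :: "'e set" where A:
    "\<And>F :: ('e \<Rightarrow>\<^sub>L real) set. finite F \<Longrightarrow> \<exists>a\<in>A. \<forall>\<phi>\<in>F. blinfun_apply \<phi> a < 1"
    "\<And>y. (\<And>k::nat. y k \<in> A) \<Longrightarrow> \<exists>\<phi> :: 'e \<Rightarrow>\<^sub>L real. \<not> (\<lambda>k. blinfun_apply \<phi> (y k)) \<longlonglongrightarrow> 0"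
    using weakly_clustering_set_without_null_sequence by metis
  obtain A' where A': "countable A'" "A' \<subseteq> A"
    "\<And>F :: ('e \<Rightarrow>\<^sub>L real) set. finite F \<Longrightarrow> \<exists>a\<in>A'. \<forall>\<phi>\<in>F. blinfun_apply \<phi> a < 1"
    using weak_countable_tightness[OF A(1)] by metis
  have "A' \<noteq> {}" using A'(3)[of "{}"] by auto
  then obtain a :: "nat \<Rightarrow> 'e" where a: "range a = A'" using A'(1) by (metis uncountable_def)
  obtain g where g: "g \<in> topspace (Cp X)" "T g = 0" by (rule ex_preimage)
  have "\<exists>f. f \<in> topspace (Cp X) \<and> T f = a k" for k by (rule ex_preimage[of "a k"]) blast
  then obtain f where f: "\<And>k. f k \<in> topspace (Cp X)" "\<And>k. T (f k) = a k" by metis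
  define h where "h x k = f k x - g x" for x k
  have "continuous_map X euclidean h"
    unfolding euclidean_product_topology[symmetric] continuous_map_componentwise_UNIV h_def
    using f(1) g(1) unfolding topspace_Cp by (auto intro!: continuous_map_diff)
  moreover have "uncountable (h ` topspace X)"
  proof
    assume "countable (h ` topspace X)"
    moreover have "topspace X \<noteq> {}" using infX by auto
    ultimately obtain v :: "nat \<Rightarrow> nat \<Rightarrow> real" where v: "range v = h ` topspace X"
      by (metis image_is_empty uncountable_def)
    have "\<exists>x. x \<in> topspace X \<and> v i = h x" for i using v by (metis imageE rangeI)
    then obtain p where p: "\<And>i. p i \<in> topspace X" "\<And>i. v i = h (p i)" by metis
    \<comment> \<open>Clustering of \<open>A'\<close> at 0 and continuity of the inverse of
      \<open>T\<close> give an index that is good at the first \<open>k + 1\<close> enumerated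
      points, with tolerance shrinking in \<open>k\<close>.\<close>
    have "\<exists>j. \<forall>i\<le>k. \<bar>f j (p i) - g (p i)\<bar> < 1 / (real k + 1)" for k :: nat
    proof -
      have "\<exists>(m::nat) (\<phi> :: nat \<Rightarrow> 'e \<Rightarrow>\<^sub>L real).
        \<forall>f\<in>topspace (Cp X). (\<forall>i<m. blinfun_apply (\<phi> i) (T f - T g) < 1) \<longrightarrow> \<bar>f (p i) - g (p i)\<bar> < 1 / (real k + 1)" for i
        by (rule evaluation_small[OF g(1) p(1)[of i], of "1 / (real k + 1)"]) auto
      then obtain m :: "nat \<Rightarrow> nat" and \<phi> :: "nat \<Rightarrow> nat \<Rightarrow> 'e \<Rightarrow>\<^sub>L real" where
        m: "\<And>i. \<forall>f\<in>topspace (Cp X). (\<forall>j<m i. blinfun_apply (\<phi> i j) (T f - T g) < 1) \<longrightarrow> \<bar>f (p i) - g (p i)\<bar> < 1 / (real k + 1)"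
        by metis
      have "finite (\<Union>i\<le>k. \<phi> i ` {..<m i})" by auto
      then obtain b where b: "b \<in> A'" "\<forall>\<psi>\<in>(\<Union>i\<le>k. \<phi> i ` {..<m i}). blinfun_apply \<psi> b < 1" using A'(3) by blast
      then obtain j where j: "b = a j" using a by auto
      have "\<bar>f j (p i) - g (p i)\<bar> < 1 / (real k + 1)" if "i \<le> k" for i
      proof -
        have "\<forall>l<m i. blinfun_apply (\<phi> i l) (T (f j) - T g) < 1" using b(2) that by (auto simp: j f(2) g(2))
        then show ?thesis using m f(1) by blast
      qed
      then show ?thesis by blast
    qed
    then obtain j where j: "\<And>k i. i \<le> k \<Longrightarrow> \<bar>f (j k) (p i) - g (p i)\<bar> < 1 / (real k + 1)" by metis
    have "(\<lambda>k. blinfun_apply \<psi> (a (j k))) \<longlonglongrightarrow> 0" for \<psi> :: "'e \<Rightarrow>\<^sub>L real"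
    proof (rule tendstoI)
      fix r :: real assume "r > 0"
      obtain D \<delta> where D: "finite D" "D \<subseteq> topspace X" "\<delta> > (0::real)"
        "\<forall>f\<in>topspace (Cp X). (\<forall>a\<in>D. \<bar>f a - g a\<bar> < \<delta>) \<longrightarrow> (\<forall>\<phi>\<in>{\<psi>, -\<psi>}. blinfun_apply \<phi> (T f - T g) < r)"
        by (rule functionals_small[OF g(1) _ \<open>r > 0\<close>, of "{\<psi>, -\<psi>}"]) blast+
      have "\<forall>\<^sub>F k in sequentially. \<forall>x\<in>D. \<bar>f (j k) x - g x\<bar> < \<delta>"
      proof (rule eventually_ball_finite[OF D(1)], intro ballI)
        fix x assume "x \<in> D"
        then have "h x \<in> range v" using v D(2) by auto
        \<comment> \<open>\<open>x\<close> shares the values of all \<open>f j - g\<close> with some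
          enumerated point, so convergence at the enumerated points gives it on all of
          \<open>X\<close>.\<close>
        then obtain i where i: "h x = h (p i)" using p(2) by auto
        have "\<forall>\<^sub>F k :: nat in sequentially. real k > 1 / \<delta>"
          using filterlim_real_sequentially unfolding filterlim_at_top_dense by blast
        then show "\<forall>\<^sub>F k in sequentially. \<bar>f (j k) x - g x\<bar> < \<delta>"
          using eventually_ge_at_top[of i]
        proof eventually_elim
          case (elim k)
          have "\<bar>f (j k) x - g x\<bar> = \<bar>f (j k) (p i) - g (p i)\<bar>" using fun_cong[OF i, of "j k"] unfolding h_def by simp
          also have "\<dots> < 1 / (real k + 1)" using j elim(2) by blast
          also have "\<dots> < \<delta>"
          proof -
            have "1 < \<delta> * real k" using elim(1) D(3) by (simp add: field_simps)
            then have "1 < \<delta> * (real k + 1)" using D(3) by (simp add: distrib_left)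
            then show ?thesis by (simp add: field_simps)
          qed
          finally show ?case .
        qed
      qed
      then show "\<forall>\<^sub>F k in sequentially. dist (blinfun_apply \<psi> (a (j k))) 0 < r"
      proof eventually_elim
        case (elim k)
        then have "\<forall>\<phi>\<in>{\<psi>, -\<psi>}. blinfun_apply \<phi> (T (f (j k)) - T g) < r" using D(4) f(1) by blast
        then show ?case by (auto simp: f(2) g(2) uminus_blinfun.rep_eq)
      qed
    qed
    moreover have "a (j k) \<in> A" for k using a A'(2) by auto
    ultimately show False using A(2)[of "\<lambda>k. a (j k)"] by blast
  qed
  ultimately show thesis by (rule that)
qed

section \<open>The copy of \<open>ell1\<close> in the Banach space\<close>

text \<open>Baire's theorem for bounded continuous functions on the target of \<open>h\<close> makes
  \<open>T\<close> bounded on the image under \<open>G\<close> of a ball. Uncountably many points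
  with distinct \<open>h\<close>-values, all controlled by \<open>m\<close> functionals of norm at
  most \<open>m\<close>, feed \<open>exists_independent_sequence\<close>; the colour is the index
  \<open>i < m\<close>.\<close>

lemma contains_ell1_if_uncountable_metrizable_image:
  fixes h :: "'x \<Rightarrow> nat \<Rightarrow> real"
  assumes h: "continuous_map X euclidean h" and unc: "uncountable (h ` topspace X)"
  shows "contains_closed_copy_of_ell1 TYPE('e)"
proof -
  define G where "G g = (\<lambda>x\<in>topspace X. apply_bcontfun g (h x))" for g :: "(nat \<Rightarrow> real) \<Rightarrow>\<^sub>C real"
  have G_cont: "continuous_map X euclideanreal (\<lambda>x. apply_bcontfun g (h x))" for g
    using continuous_map_compose[OF h, of euclideanreal "apply_bcontfun g"] by (simp add: o_def)
  have G_in: "G g \<in> topspace (Cp X)" for g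
    unfolding G_def by (rule restrict_in_Cp[OF G_cont])
  have "continuous_map euclidean (Cp X) G"
    unfolding Cp_def continuous_map_in_subtopology
  proof (intro conjI)
    show "continuous_map euclidean (product_topology (\<lambda>_. euclideanreal) (topspace X)) G"
      by (rule continuous_map_coordinatewise_then_product) (auto simp: G_def continuous_on_bcontfun_eval)
  qed (use G_in in \<open>auto simp: topspace_Cp\<close>)
  then have \<phi>TG: "continuous_on UNIV (\<lambda>g. blinfun_apply \<phi> (T (G g)))" for \<phi> :: "'e \<Rightarrow>\<^sub>L real"
    using continuous_map_compose[OF _ functional_continuous, of euclidean G \<phi>] by (simp add: o_def)
  define C where "C n = {g. norm (T (G g)) \<le> real n}" for n
  \<comment> \<open>Norm balls are intersections of half-spaces, whose preimages are closed even
    though \<open>T\<close> is continuous only into the weak topology.\<close>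
  have "closed (C n)" for n
  proof -
    have "C n = (\<Inter>\<phi>\<in>{\<phi> :: 'e \<Rightarrow>\<^sub>L real. norm \<phi> \<le> 1}. {g. blinfun_apply \<phi> (T (G g)) \<le> real n})"
      unfolding C_def by (subst norm_le_iff_functionals) auto
    moreover have "closed {g. blinfun_apply \<phi> (T (G g)) \<le> real n}" for \<phi> :: "'e \<Rightarrow>\<^sub>L real"
      by (intro closed_Collect_le \<phi>TG continuous_on_const)
    ultimately show ?thesis by auto
  qed
  moreover have "(\<Union>n. C n) = UNIV"
    unfolding C_def using real_arch_simple by auto
  ultimately obtain N g0 \<epsilon> where \<epsilon>: "\<epsilon> > 0" and ball: "cball g0 \<epsilon> \<subseteq> C N"
    by (rule Baire_closed_cover)
  define f0 where "f0 = G g0"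
  have f0: "f0 \<in> topspace (Cp X)" unfolding f0_def by (rule G_in)
  obtain \<F> :: "((nat \<Rightarrow> real) \<Rightarrow>\<^sub>C real) set" where \<F>: "countable \<F>"
    "\<And>g z. g \<in> \<F> \<Longrightarrow> 0 \<le> apply_bcontfun g z \<and> apply_bcontfun g z \<le> \<epsilon>"
    "\<And>A P. finite A \<Longrightarrow> finite P \<Longrightarrow> A \<inter> P = {} \<Longrightarrow>
      \<exists>g\<in>\<F>. (\<forall>a\<in>A. apply_bcontfun g a = 0) \<and> (\<forall>p\<in>P. apply_bcontfun g p = \<epsilon>)"
    using countable_separating_bcontfuns[OF \<epsilon>] by metis
  \<comment> \<open>One point from each fibre of \<open>h\<close>, so that functions of
    \<open>h\<close> separate finite subsets.\<close>
  define Y where "Y = inv_into (topspace X) h ` h ` topspace X"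
  have YX: "Y \<subseteq> topspace X" unfolding Y_def by (auto intro: inv_into_into)
  have injY: "inj_on h Y" unfolding Y_def by (auto simp: inj_on_def f_inv_into_f)
  have "h ` Y = h ` topspace X" unfolding Y_def by (rule image_inv_into_cancel[OF refl subset_refl])
  then have "uncountable Y" using unc by (metis countable_image)
  have "\<exists>(m::nat) (\<phi> :: nat \<Rightarrow> 'e \<Rightarrow>\<^sub>L real). (\<forall>i. norm (\<phi> i) \<le> m) \<and>
      (\<forall>f\<in>topspace (Cp X). (\<forall>i<m. blinfun_apply (\<phi> i) (T f - T f0) < 1) \<longrightarrow> \<bar>f y - f0 y\<bar> < \<epsilon>)" if y: "y \<in> Y" for y
    by (rule evaluation_small[OF f0 subsetD[OF YX y] \<epsilon>]) blast
  then obtain \<mu> :: "'x \<Rightarrow> nat" and \<phi> :: "'x \<Rightarrow> nat \<Rightarrow> 'e \<Rightarrow>\<^sub>L real" where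
    \<mu>: "\<And>y. y \<in> Y \<Longrightarrow> (\<forall>i. norm (\<phi> y i) \<le> \<mu> y) \<and>
      (\<forall>f\<in>topspace (Cp X). (\<forall>i<\<mu> y. blinfun_apply (\<phi> y i) (T f - T f0) < 1) \<longrightarrow> \<bar>f y - f0 y\<bar> < \<epsilon>)"
    by metis
  have "\<exists>m. uncountable {y \<in> Y. \<mu> y = m}"
  proof (rule ccontr)
    assume "\<not> ?thesis"
    then have "countable (\<Union>m. {y \<in> Y. \<mu> y = m})" by (intro countable_UN) auto
    moreover have "(\<Union>m. {y \<in> Y. \<mu> y = m}) = Y" by auto
    ultimately show False using \<open>uncountable Y\<close> by simp
  qed
  then obtain m where m: "uncountable {y \<in> Y. \<mu> y = m}" by blast
  define Z where "Z = {y \<in> Y. \<mu> y = m}"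
  have ZY: "Z \<subseteq> Y" unfolding Z_def by auto
  have \<phi>_norm: "norm (\<phi> y i) \<le> real m" if "y \<in> Z" for y i using \<mu>[of y] that unfolding Z_def by auto
  define d where "d g = T (G (g0 + g)) - T f0" for g
  have "\<exists>A. finite A \<and> (\<forall>Q. finite Q \<and> Q \<subseteq> Z - A \<longrightarrow> (\<exists>g\<in>\<F>.
      (\<forall>p\<in>P. \<forall>i\<in>{..<m}. blinfun_apply (\<phi> p i) (d g) < 1 / 2) \<and> (\<forall>q\<in>Q. \<exists>i\<in>{..<m}. 1 \<le> blinfun_apply (\<phi> q i) (d g))))"
    if P: "finite P" "P \<subseteq> Z" for P
  proof -
    have finP: "finite (\<Union>p\<in>P. \<phi> p ` {..<m})" using P(1) by auto
    have half: "(0::real) < 1 / 2" by simp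
    obtain D \<delta> where D: "finite D" "D \<subseteq> topspace X" "\<delta> > (0::real)"
      "\<forall>f\<in>topspace (Cp X). (\<forall>a\<in>D. \<bar>f a - f0 a\<bar> < \<delta>) \<longrightarrow>
        (\<forall>\<psi>\<in>(\<Union>p\<in>P. \<phi> p ` {..<m}). blinfun_apply \<psi> (T f - T f0) < 1 / 2)"
      by (rule functionals_small[OF f0 finP half])
    \<comment> \<open>The exceptional points: those sharing an \<open>h\<close>-value with
      \<open>D\<close>, where a function of \<open>h\<close> vanishing on \<open>D\<close> vanishes
      too.\<close>
    define A where "A = {y \<in> Z. h y \<in> h ` D}"
    have "inj_on h A" using injY ZY by (auto simp: A_def intro: inj_on_subset)
    moreover have "finite (h ` A)" using D(1) by (auto simp: A_def intro: finite_subset[of _ "h ` D"])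
    ultimately have "finite A" by (simp add: finite_image_iff)
    moreover have "\<exists>g\<in>\<F>. (\<forall>p\<in>P. \<forall>i\<in>{..<m}. blinfun_apply (\<phi> p i) (d g) < 1 / 2) \<and>
        (\<forall>q\<in>Q. \<exists>i\<in>{..<m}. 1 \<le> blinfun_apply (\<phi> q i) (d g))" if Q: "finite Q" "Q \<subseteq> Z - A" for Q
    proof -
      have "h q \<notin> h ` D" if "q \<in> Q" for q using subsetD[OF Q(2) that] unfolding A_def by simp
      then have "\<forall>z\<in>h ` Q. z \<notin> h ` D" by simp
      then have "h ` D \<inter> h ` Q = {}" by (metis disjoint_iff)
      then obtain g where g: "g \<in> \<F>" "\<forall>a\<in>h ` D. apply_bcontfun g a = 0" "\<forall>p\<in>h ` Q. apply_bcontfun g p = \<epsilon>"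
        using \<F>(3)[of "h ` D" "h ` Q"] D(1) Q(1) by blast
      have Gx: "G (g0 + g) x = f0 x + apply_bcontfun g (h x)" if "x \<in> topspace X" for x
        using that unfolding G_def f0_def by (simp add: plus_bcontfun.rep_eq)
      have "\<forall>a\<in>D. \<bar>G (g0 + g) a - f0 a\<bar> < \<delta>" using g(2) D(2,3) by (auto simp: Gx)
      then have lo: "\<forall>\<psi>\<in>(\<Union>p\<in>P. \<phi> p ` {..<m}). blinfun_apply \<psi> (d g) < 1 / 2"
        using D(4) G_in unfolding d_def by blast
      \<comment> \<open>Raising \<open>f0\<close> by \<open>\<epsilon>\<close> at \<open>q\<close>
        violates the evaluation bound there, so one of the functionals of \<open>q\<close> must
        reach 1.\<close>
      have "\<exists>i\<in>{..<m}. 1 \<le> blinfun_apply (\<phi> q i) (d g)" if q: "q \<in> Q" for q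
      proof (rule ccontr)
        assume "\<not> ?thesis"
        then have "\<forall>i<m. blinfun_apply (\<phi> q i) (T (G (g0 + g)) - T f0) < 1" unfolding d_def by (auto simp: not_le)
        moreover have "q \<in> Y" "\<mu> q = m" using q Q(2) unfolding Z_def by auto
        ultimately have "\<bar>G (g0 + g) q - f0 q\<bar> < \<epsilon>" using \<mu>[of q] G_in by blast
        moreover have "q \<in> topspace X" using \<open>q \<in> Y\<close> YX by blast
        ultimately show False using g(3) q by (auto simp: Gx)
      qed
      then show ?thesis using lo g(1) by (intro bexI[of _ g]) auto
    qed
    ultimately show ?thesis by blast
  qed
  then have "\<exists>i\<in>{..<m}. \<exists>g :: nat \<Rightarrow> (nat \<Rightarrow> real) \<Rightarrow>\<^sub>C real. (\<forall>k. g k \<in> \<F>) \<and> (\<forall>n s. \<exists>y\<in>Z. \<forall>k<n.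
      if s k then 1 \<le> blinfun_apply (\<phi> y i) (d (g k)) else blinfun_apply (\<phi> y i) (d (g k)) < 1 / 2)"
    by (rule exists_independent_sequence[OF m[folded Z_def] \<F>(1) finite_lessThan])
  then obtain i and g :: "nat \<Rightarrow> (nat \<Rightarrow> real) \<Rightarrow>\<^sub>C real" where i: "i \<in> {..<m}" and g: "\<And>k. g k \<in> \<F>"
    and ind: "\<And>n s. \<exists>y\<in>Z. \<forall>k<n. if s k then 1 \<le> blinfun_apply (\<phi> y i) (d (g k)) else blinfun_apply (\<phi> y i) (d (g k)) < 1 / 2"
    by blast
  have "m > 0" using i by auto
  \<comment> \<open>The constant is the gap 1/2 between high and low values divided by
    \<open>2 * m\<close>, the norm bound for a difference of two functionals. The bound
    \<open>2 * N\<close> comes from two values of \<open>T\<close> of norm at most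
    \<open>N\<close>.\<close>
  show ?thesis
  proof (rule contains_ell1_if_lower_estimate[of "1 / (4 * real m)" "\<lambda>k. d (g k)" "2 * real N"])
    show "1 / (4 * real m) > 0" using \<open>m > 0\<close> by simp
    show "norm (d (g k)) \<le> 2 * real N" for k
    proof -
      have "dist g0 (g0 + g k) \<le> \<epsilon>"
        by (rule dist_bound) (use \<F>(2)[OF g[of k]] in \<open>auto simp: dist_real_def plus_bcontfun.rep_eq\<close>)
      then have "g0 + g k \<in> C N" "g0 \<in> C N" using ball \<epsilon> by auto
      then have "norm (T (G (g0 + g k))) \<le> real N" "norm (T f0) \<le> real N" unfolding C_def f0_def by auto
      then show ?thesis
        unfolding d_def using norm_triangle_ineq4[of "T (G (g0 + g k))" "T f0"] by linarith
    qed
    show "1 / (4 * real m) * (\<Sum>k<n. \<bar>a k\<bar>) \<le> norm (\<Sum>k<n. a k *\<^sub>R d (g k))" for n a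
    proof -
      obtain y where y: "y \<in> Z" "\<forall>k<n. if 0 \<le> a k then 1 \<le> blinfun_apply (\<phi> y i) (d (g k)) else blinfun_apply (\<phi> y i) (d (g k)) < 1 / 2"
        using ind[of n "\<lambda>k. 0 \<le> a k"] by blast
      obtain z where z: "z \<in> Z" "\<forall>k<n. if a k < 0 then 1 \<le> blinfun_apply (\<phi> z i) (d (g k)) else blinfun_apply (\<phi> z i) (d (g k)) < 1 / 2"
        using ind[of n "\<lambda>k. a k < 0"] by blast
      \<comment> \<open>The patterns at \<open>y\<close> and \<open>z\<close> are complementary, so
        on \<open>d (g k)\<close> the difference \<open>\<psi>\<close> is at least 1/2 or at most
        -1/2 according to the sign of \<open>a k\<close>. Low values need not be negative, so a
        single functional would not do.\<close>
      define \<psi> where "\<psi> = \<phi> y i - \<phi> z i"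
      have "norm \<psi> \<le> 2 * real m"
        unfolding \<psi>_def using norm_triangle_ineq4[of "\<phi> y i" "\<phi> z i"] \<phi>_norm[OF y(1), of i] \<phi>_norm[OF z(1), of i] by linarith
      have "\<bar>a k\<bar> / 2 \<le> a k * blinfun_apply \<psi> (d (g k))" if "k < n" for k
      proof (cases "0 \<le> a k")
        case True
        then have "1 / 2 \<le> blinfun_apply \<psi> (d (g k))"
          using y(2)[rule_format, OF that] z(2)[rule_format, OF that] unfolding \<psi>_def by (simp add: minus_blinfun.rep_eq)
        from mult_left_mono[OF this True] show ?thesis using True by simp
      next
        case False
        then have "blinfun_apply \<psi> (d (g k)) \<le> - (1 / 2)"
          using y(2)[rule_format, OF that] z(2)[rule_format, OF that] unfolding \<psi>_def by (simp add: minus_blinfun.rep_eq)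
        from mult_left_mono_neg[OF this, of "a k"] show ?thesis using False by simp
      qed
      then have "(\<Sum>k<n. \<bar>a k\<bar> / 2) \<le> (\<Sum>k<n. a k * blinfun_apply \<psi> (d (g k)))" by (intro sum_mono) auto
      also have "\<dots> = blinfun_apply \<psi> (\<Sum>k<n. a k *\<^sub>R d (g k))" by (simp add: blinfun.sum_right blinfun.scaleR_right)
      also have "\<dots> \<le> norm \<psi> * norm (\<Sum>k<n. a k *\<^sub>R d (g k))" using norm_blinfun[of \<psi>] by (metis abs_le_D1 real_norm_def)
      also have "\<dots> \<le> 2 * real m * norm (\<Sum>k<n. a k *\<^sub>R d (g k))"
        using \<open>norm \<psi> \<le> 2 * real m\<close> by (intro mult_right_mono) auto
      finally have "(\<Sum>k<n. \<bar>a k\<bar>) / 2 \<le> 2 * real m * norm (\<Sum>k<n. a k *\<^sub>R d (g k))" by (simp add: sum_divide_distrib)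
      then show ?thesis using \<open>m > 0\<close> by (simp add: field_simps)
    qed
  qed
qed

end

theorem theorem1p7:
  fixes X :: "'x topology" and T :: "('x \<Rightarrow> real) \<Rightarrow> 'e::banach"
  assumes "tychonoff_space X"
    and "infinite (topspace X)"
    and "homeomorphic_map (Cp X) weak_topology T"
  shows "(\<exists>K :: nat \<Rightarrow> 'x set.
            topspace X = (\<Union>n. K n) \<and> (\<forall>n. compactin X (K n)) \<and>
            (\<exists>n. \<not> scattered_in X (K n)))
       \<and> contains_closed_copy_of_ell1 TYPE('e)"
proof -
  interpret Cp_weak_homeomorphism X T
    using assms by unfold_locales (auto simp: tychonoff_space_def)
  obtain h :: "'x \<Rightarrow> nat \<Rightarrow> real" where h: "continuous_map X euclidean h" "uncountable (h ` topspace X)"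
    by (rule uncountable_metrizable_image)
  obtain K :: "nat \<Rightarrow> 'x set" where K: "topspace X = (\<Union>n. K n)" "\<forall>n. compactin X (K n)"
    using sigma_compact by blast
  \<comment> \<open>Scattered pieces would have countable images under \<open>h\<close>, and
    countably many of them cannot fill an uncountable image.\<close>
  have "\<exists>n. \<not> scattered_in X (K n)"
  proof (rule ccontr)
    assume "\<not> ?thesis"
    then have "countable (h ` K n)" for n
      using compact_scattered_countable_image[OF completely_regular_imp_regular_space[OF creg] _ _ h(1)] K(2)
      by blast
    then have "countable (\<Union>n. h ` K n)" by auto
    then show False using h(2) by (simp add: K(1) image_UN)
  qed
  with K contains_ell1_if_uncountable_metrizable_image[OF h] show ?thesis by blast
qed

end
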